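(* Let $L$ be the standard Iwasawa subgroup of $G=G_{2(2)}$. The left-invariant metrics $g^{(TS)}$ and $g^{(ST)}$ on $L$ (equivalently, the left-invariant metrics $g_1$ and $g_2$ on $L$) are not related by any automorphism of $L$; that is, there is no $F\in\mathrm{Aut}(L)$ with $F^*g^{(TS)}=g^{(ST)}$, and there is no $F\in\mathrm{Aut}(L)$ with $F^*g_1=g_2$.
   Context: Lie algebra $\mathfrak{g}$ of $G$: $V=\mathbb{R}^3$ with standard basis $(e_1,e_2,e_3)$, dual basis $(e^1,e^2,e^3)$ of $V^*$, and $e_i^j=e_i\otimes e^j\in\mathfrak{gl}(V)$. As a vector space $\mathfrak{g}=V\oplus\mathfrak{sl}(V)\oplus V^*$; $\mathfrak{sl}(V)$ is a subalgebra acting on $V$ and $V^*$ by the standard and the dual representation, and the remaining brackets are, for $x,y\in V$, $\xi,\eta\in V^*$, $[x,y]=-2\,x\times y$, $[\xi,\eta]=2\,\xi\times\eta$, $[x,\xi]=3x\otimes\xi-\xi(x)\mathrm{Id}\in\mathfrak{sl}(V)$, where $x\times y=\det(x,y,\cdot)\in V^*$ and $\xi\times\eta=\det^{-1}(\xi,\eta,\cdot)\in V^{**}=V$ (so $e_1\times e_2=e^3$, $e^1\times e^2=e_3$, and cyclically). $\mathfrak{a}=\{\sum_i\lambda_ie_i^i\mid\sum_i\lambda_i=0\}$. $G$ is the simply connected Lie group with Lie algebra $\mathfrak{g}$. $\mathfrak{g}_{ev}=\mathfrak{a}+\mathrm{span}\{e_3,e^3,e_1^2,e_2^1\}$, $\mathfrak{g}_{odd}=\mathrm{span}\{e_1,e_2,e^1,e^2,e_1^3,e_2^3,e_3^1,e_3^2\}$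 (a $\mathbb{Z}_2$-grading), $\mathfrak{l}=\mathfrak{a}+\mathrm{span}\{e_1,e^2,e^3,e_1^2,e_1^3,e_2^3\}$. $G_{ev},L\subset G$ are the connected Lie subgroups with Lie algebras $\mathfrak{g}_{ev},\mathfrak{l}$; $L$ is simply connected. $S=G/G_{ev}$, $o=eG_{ev}$, and $g_S$ is the $G$-invariant metric on $S$ which on $T_oS\cong\mathfrak{g}_{odd}$ equals the restriction of $\frac18B$, $B$ the Killing form of $\mathfrak{g}$. Basis of $\mathfrak{l}$: $\mathcal{V}_1=-3e_1^3$, $\mathcal{V}_2=\frac12(e_1^1-e_3^3)$, $\mathcal{V}_3=\frac1{\sqrt3}e^2$, $\mathcal{V}_4=\frac1{2\sqrt3}(e_1^1-2e_2^2+e_3^3)$, $\mathcal{V}_5=\sqrt3e_2^3$, $\mathcal{V}_6=e^3$, $\mathcal{V}_7=-\sqrt3e_1^2$, $\mathcal{V}_8=-e_1$. The left-invariant metrics $g^{(TS)}$, $g^{(ST)}$ on $L$ have Gram matrices on $\mathfrak{l}$ in the basis $(\mathcal{V}_1,\dots,\mathcal{V}_8)$ equal to $\frac14\mathrm{diag}(-1,1,-1,1,-1,1,1,-1)$ and $\frac14\mathrm{diag}(1,1,1,1,-1,-1,-1,-1)$, respectively. The left-invariant metrics $g_1=\phi_1^*g_S$, $g_2=\phi_2^*g_S$ are defined by $\phi_i:L\to S$, $\phi_i(x)=(a_ixa_i^{-1})\cdot o$, with $a_1=\exp(e^1+e_3^1)$, $a_2=\exp(e_3^2+e^1)$. *)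

theory Defs
  imports "HOL-Analysis.Analysis" "HOL-Algebra.Left_Coset"
begin

section \<open>Smooth manifolds\<close>

primrec Ck_on :: "nat \<Rightarrow> 'a::real_normed_vector set \<Rightarrow> ('a \<Rightarrow> 'b::real_normed_vector) \<Rightarrow> bool" where
  "Ck_on 0 S f = continuous_on S f"
| "Ck_on (Suc k) S f =
     ((\<forall>x\<in>S. f differentiable at x) \<and> (\<forall>v. Ck_on k S (\<lambda>x. frechet_derivative f (at x) v)))"

text \<open>Only meant for open \<open>S\<close> and functions between finite-dimensional spaces.\<close>

definition smooth_on :: "'a::real_normed_vector set \<Rightarrow> ('a \<Rightarrow> 'b::real_normed_vector) \<Rightarrow> bool" where
  "smooth_on S f \<longleftrightarrow> (\<forall>k. Ck_on k S f)"

record ('a, 'e) manifold =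
  man_top :: "'a topology"
  man_atlas :: "('a set \<times> ('a \<Rightarrow> 'e)) set"

definition man_space :: "('a, 'e) manifold \<Rightarrow> 'a set" where
  "man_space M = topspace (man_top M)"

definition smooth_manifold :: "('a, 'e::euclidean_space) manifold \<Rightarrow> bool" where
  "smooth_manifold M \<longleftrightarrow>
     Hausdorff_space (man_top M) \<and> second_countable (man_top M) \<and>
     man_space M = (\<Union>(U, \<phi>)\<in>man_atlas M. U) \<and>
     (\<forall>(U, \<phi>)\<in>man_atlas M. openin (man_top M) U \<and> open (\<phi> ` U) \<and>
        homeomorphic_map (subtopology (man_top M) U) (top_of_set (\<phi> ` U)) \<phi>) \<and>
     (\<forall>(U, \<phi>)\<in>man_atlas M. \<forall>(V, \<psi>)\<in>man_atlas M.
        smooth_on (\<phi> ` (U \<inter> V)) (\<psi> \<circ> inv_into U \<phi>))"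

definition smooth_map ::
    "('a, 'e::euclidean_space) manifold \<Rightarrow> ('b, 'f::euclidean_space) manifold \<Rightarrow> ('a \<Rightarrow> 'b) \<Rightarrow> bool" where
  "smooth_map M N F \<longleftrightarrow>
     continuous_map (man_top M) (man_top N) F \<and>
     (\<forall>(U, \<phi>)\<in>man_atlas M. \<forall>(V, \<psi>)\<in>man_atlas N.
        smooth_on (\<phi> ` (U \<inter> F -` V)) (\<psi> \<circ> F \<circ> inv_into U \<phi>))"

definition euclidean_manifold :: "('e::euclidean_space, 'e) manifold" where
  "euclidean_manifold = \<lparr>man_top = euclidean, man_atlas = {(UNIV, \<lambda>x. x)}\<rparr>"

definition prod_manifold ::
    "('a, 'e) manifold \<Rightarrow> ('b, 'f) manifold \<Rightarrow> ('a \<times> 'b, 'e \<times> 'f) manifold" where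
  "prod_manifold M N =
     \<lparr>man_top = prod_topology (man_top M) (man_top N),
      man_atlas = {(U \<times> V, map_prod \<phi> \<psi>) | U \<phi> V \<psi>. (U, \<phi>) \<in> man_atlas M \<and> (V, \<psi>) \<in> man_atlas N}\<rparr>"

definition smooth_functions :: "('a, 'e::euclidean_space) manifold \<Rightarrow> ('a \<Rightarrow> real) set" where
  "smooth_functions M = {f. smooth_map M euclidean_manifold f}"

text \<open>The topological-space analogue of \<^const>\<open>simply_connected\<close>, which is stated for sets only.\<close>

definition simply_connected_space :: "'a topology \<Rightarrow> bool" where
  "simply_connected_space T \<longleftrightarrow>
     (\<forall>p q. pathin T p \<and> p 1 = p 0 \<and> pathin T q \<and> q 1 = q 0 \<longrightarrow>
        homotopic_with (\<lambda>r. r 1 = r 0) (top_of_set {0..1::real}) T p q)"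


section \<open>Tangent vectors, vector fields and metrics\<close>

text \<open>
  A tangent vector at \<open>p\<close> is the directional derivative \<open>f \<mapsto> (f \<circ> c)'(0)\<close> of smooth functions along a
  smooth curve \<open>c\<close> through \<open>p\<close>. Curves defined on all of the real line suffice, since every curve
  defined near \<open>0\<close> can be reparametrised to such a curve with the same velocity.
  Functionals are \<open>0\<close> on non-smooth functions, so that equality and the pointwise linear structure
  are those of the tangent space.
\<close>

type_synonym 'a tangent = "('a \<Rightarrow> real) \<Rightarrow> real"

definition velocity :: "('a, 'e::euclidean_space) manifold \<Rightarrow> (real \<Rightarrow> 'a) \<Rightarrow> 'a tangent" where
  "velocity M c = (\<lambda>f. if f \<in> smooth_functions M then deriv (f \<circ> c) 0 else 0)"

definition tangent_space :: "('a, 'e::euclidean_space) manifold \<Rightarrow> 'a \<Rightarrow> 'a tangent set" where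
  "tangent_space M p = {velocity M c | c. smooth_map euclidean_manifold M c \<and> c 0 = p}"

definition differential ::
    "('b, 'f::euclidean_space) manifold \<Rightarrow> ('a \<Rightarrow> 'b) \<Rightarrow> 'a tangent \<Rightarrow> 'b tangent" where
  "differential N F v = (\<lambda>f. if f \<in> smooth_functions N then v (f \<circ> F) else 0)"

definition vector_fields :: "('a, 'e::euclidean_space) manifold \<Rightarrow> ('a \<Rightarrow> 'a tangent) set" where
  "vector_fields M = {X.
     (\<forall>p\<in>man_space M. X p \<in> tangent_space M p) \<and> (\<forall>p. p \<notin> man_space M \<longrightarrow> X p = (\<lambda>f. 0)) \<and>
     (\<forall>f\<in>smooth_functions M. (\<lambda>p. X p f) \<in> smooth_functions M)}"

definition vf_bracket ::
    "('a, 'e::euclidean_space) manifold \<Rightarrow> ('a \<Rightarrow> 'a tangent) \<Rightarrow> ('a \<Rightarrow> 'a tangent) \<Rightarrow> 'a \<Rightarrow> 'a tangent" where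
  "vf_bracket M X Y = (\<lambda>p f. if f \<in> smooth_functions M
     then X p (\<lambda>q. Y q f) - Y p (\<lambda>q. X q f) else 0)"

type_synonym 'a metric_tensor = "'a \<Rightarrow> 'a tangent \<Rightarrow> 'a tangent \<Rightarrow> real"

text \<open>``Metric'' means pseudo-Riemannian metric of arbitrary signature.\<close>

definition pseudo_riemannian_metric :: "('a, 'e::euclidean_space) manifold \<Rightarrow> 'a metric_tensor \<Rightarrow> bool" where
  "pseudo_riemannian_metric M g \<longleftrightarrow>
     (\<forall>p\<in>man_space M.
        (\<forall>u\<in>tangent_space M p. \<forall>v\<in>tangent_space M p. g p u v = g p v u) \<and>
        (\<forall>u\<in>tangent_space M p. \<forall>v\<in>tangent_space M p. \<forall>w\<in>tangent_space M p. \<forall>a b.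
           g p (\<lambda>f. a * u f + b * v f) w = a * g p u w + b * g p v w) \<and>
        (\<forall>u\<in>tangent_space M p. (\<forall>v\<in>tangent_space M p. g p u v = 0) \<longrightarrow> u = (\<lambda>f. 0))) \<and>
     (\<forall>X\<in>vector_fields M. \<forall>Y\<in>vector_fields M. (\<lambda>p. g p (X p) (Y p)) \<in> smooth_functions M)"

definition pullback_metric ::
    "('b, 'f::euclidean_space) manifold \<Rightarrow> ('a \<Rightarrow> 'b) \<Rightarrow> 'b metric_tensor \<Rightarrow> 'a metric_tensor" where
  "pullback_metric N F g = (\<lambda>p u v. g (F p) (differential N F u) (differential N F v))"

text \<open>Equality of tensors, disregarding their irrelevant values outside the tangent spaces.\<close>

definition metric_eq ::
    "('a, 'e::euclidean_space) manifold \<Rightarrow> 'a metric_tensor \<Rightarrow> 'a metric_tensor \<Rightarrow> bool" where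
  "metric_eq M g h \<longleftrightarrow>
     (\<forall>p\<in>man_space M. \<forall>u\<in>tangent_space M p. \<forall>v\<in>tangent_space M p. g p u v = h p u v)"


section \<open>Lie groups\<close>

record ('a, 'e) lie_group_struct = "'a monoid" +
  lg_man :: "('a, 'e) manifold"

definition lie_group :: "('a, 'e::euclidean_space) lie_group_struct \<Rightarrow> bool" where
  "lie_group G \<longleftrightarrow>
     group G \<and> smooth_manifold (lg_man G) \<and> man_space (lg_man G) = carrier G \<and>
     smooth_map (prod_manifold (lg_man G) (lg_man G)) (lg_man G) (\<lambda>(x, y). x \<otimes>\<^bsub>G\<^esub> y) \<and>
     smooth_map (lg_man G) (lg_man G) (\<lambda>x. inv\<^bsub>G\<^esub> x)"

definition lie_aut :: "('a, 'e::euclidean_space) lie_group_struct \<Rightarrow> ('a \<Rightarrow> 'a) set" where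
  "lie_aut G = {F \<in> iso G G. smooth_map (lg_man G) (lg_man G) F \<and>
                 smooth_map (lg_man G) (lg_man G) (inv_into (carrier G) F)}"

definition left_invariant_fields ::
    "('a, 'e::euclidean_space) lie_group_struct \<Rightarrow> ('a \<Rightarrow> 'a tangent) set" where
  "left_invariant_fields G = {X \<in> vector_fields (lg_man G).
     \<forall>a\<in>carrier G. \<forall>p\<in>carrier G. differential (lg_man G) (\<lambda>x. a \<otimes>\<^bsub>G\<^esub> x) (X p) = X (a \<otimes>\<^bsub>G\<^esub> p)}"

definition left_invariant_metric ::
    "('a, 'e::euclidean_space) lie_group_struct \<Rightarrow> 'a metric_tensor \<Rightarrow> bool" where
  "left_invariant_metric G g \<longleftrightarrow> pseudo_riemannian_metric (lg_man G) g \<and>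
     (\<forall>a\<in>carrier G. metric_eq (lg_man G) (pullback_metric (lg_man G) (\<lambda>x. a \<otimes>\<^bsub>G\<^esub> x) g) g)"

text \<open>
  \<open>is_lie_exp G X a\<close> means \<open>a = exp X\<close>: the point \<open>a\<close> is reached at time \<open>1\<close> by the (unique)
  one-parameter subgroup whose initial velocity is the value of \<open>X\<close> at the identity.
\<close>

definition is_lie_exp ::
    "('a, 'e::euclidean_space) lie_group_struct \<Rightarrow> ('a \<Rightarrow> 'a tangent) \<Rightarrow> 'a \<Rightarrow> bool" where
  "is_lie_exp G X a \<longleftrightarrow>
     (\<exists>\<gamma>. smooth_map euclidean_manifold (lg_man G) \<gamma> \<and> (\<forall>s t::real. \<gamma> (s + t) = \<gamma> s \<otimes>\<^bsub>G\<^esub> \<gamma> t) \<and>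
          velocity (lg_man G) \<gamma> = X \<one>\<^bsub>G\<^esub> \<and> \<gamma> 1 = a)"

text \<open>\<open>H\<close> carries its own topology and smooth structure: the inclusion need only be an immersion.\<close>

definition lie_subgroup ::
    "('a, 'f::euclidean_space) lie_group_struct \<Rightarrow> ('a, 'e::euclidean_space) lie_group_struct \<Rightarrow> bool" where
  "lie_subgroup H G \<longleftrightarrow>
     lie_group H \<and> subgroup (carrier H) G \<and>
     (\<forall>x\<in>carrier H. \<forall>y\<in>carrier H. x \<otimes>\<^bsub>H\<^esub> y = x \<otimes>\<^bsub>G\<^esub> y) \<and> \<one>\<^bsub>H\<^esub> = \<one>\<^bsub>G\<^esub> \<and>
     smooth_map (lg_man H) (lg_man G) (\<lambda>x. x) \<and>
     (\<forall>p\<in>carrier H. inj_on (differential (lg_man G) (\<lambda>x. x)) (tangent_space (lg_man H) p))"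

text \<open>
  \<open>M\<close> is the set of left cosets \<open>G/H\<close> with its quotient manifold structure, i.e. the unique one for
  which the projection is a smooth submersion.
\<close>

definition homogeneous_space ::
    "('a, 'e::euclidean_space) lie_group_struct \<Rightarrow> 'a set \<Rightarrow> ('a set, 's::euclidean_space) manifold \<Rightarrow> bool" where
  "homogeneous_space G H M \<longleftrightarrow>
     smooth_manifold M \<and> man_space M = lcosets\<^bsub>G\<^esub> H \<and>
     smooth_map (lg_man G) M (\<lambda>a. a <#\<^bsub>G\<^esub> H) \<and>
     (\<forall>a\<in>carrier G. differential M (\<lambda>x. x <#\<^bsub>G\<^esub> H) ` tangent_space (lg_man G) a
                      = tangent_space M (a <#\<^bsub>G\<^esub> H))"


section \<open>The split Lie algebra of type \<open>G\<^sub>2\<close>\<close>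

text \<open>
  Triples \<open>(x, A, \<xi>)\<close> with \<open>x \<in> V\<close>, \<open>A \<in> gl(V)\<close>, \<open>\<xi> \<in> V\<^sup>*\<close>, where elements of \<open>V\<^sup>*\<close> are given by
  their coordinates in the dual basis. Hence \<open>\<xi>(x)\<close> is \<open>\<xi> \<bullet> x\<close>, the dual representation is
  \<open>A \<cdot> \<xi> = - A\<^sup>T \<xi>\<close>, and both cross products are \<^const>\<open>cross3\<close>.
\<close>

type_synonym gvec = "(real^3) \<times> (real^3^3) \<times> (real^3)"

definition g2 :: "gvec set" where
  "g2 = {(x, A, \<xi>). trace A = 0}"

definition tensor :: "real^3 \<Rightarrow> real^3 \<Rightarrow> real^3^3" where
  "tensor x \<xi> = (\<chi> i j. x $ i * \<xi> $ j)"

definition pairing :: "real^3 \<Rightarrow> real^3 \<Rightarrow> real^3^3" where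
  "pairing x \<xi> = 3 *\<^sub>R tensor x \<xi> - (\<xi> \<bullet> x) *\<^sub>R mat 1"

fun g2_bracket :: "gvec \<Rightarrow> gvec \<Rightarrow> gvec" where
  "g2_bracket (x, A, \<xi>) (y, B, \<eta>) =
     (A *v y - B *v x + 2 *\<^sub>R cross3 \<xi> \<eta>,
      A ** B - B ** A + pairing x \<eta> - pairing y \<xi>,
      transpose B *v \<xi> - transpose A *v \<eta> - 2 *\<^sub>R cross3 x y)"

definition trace_on :: "'a::real_vector set \<Rightarrow> ('a \<Rightarrow> 'a) \<Rightarrow> real" where
  "trace_on W T = (let B = (SOME B. independent B \<and> span B = W) in \<Sum>b\<in>B. representation B (T b) b)"

definition killing :: "gvec \<Rightarrow> gvec \<Rightarrow> real" where
  "killing X Y = trace_on g2 (\<lambda>Z. g2_bracket X (g2_bracket Y Z))"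

definition ev :: "3 \<Rightarrow> gvec" where
  "ev i = (axis i 1, 0, 0)"

definition ecov :: "3 \<Rightarrow> gvec" where
  "ecov i = (0, 0, axis i 1)"

text \<open>\<open>emat i j\<close> is \<open>e\<^sub>i \<otimes> e\<^sup>j\<close>, with lower index \<open>i\<close> and upper index \<open>j\<close>.\<close>

definition emat :: "3 \<Rightarrow> 3 \<Rightarrow> gvec" where
  "emat i j = (0, tensor (axis i 1) (axis j 1), 0)"

definition cartan :: "gvec set" where
  "cartan = {\<Sum>i\<in>UNIV. c i *\<^sub>R emat i i | c. (\<Sum>i\<in>UNIV. c i) = 0}"

definition g_ev :: "gvec set" where
  "g_ev = {H + X | H X. H \<in> cartan \<and> X \<in> span {ev 3, ecov 3, emat 1 2, emat 2 1}}"

definition g_odd :: "gvec set" where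
  "g_odd = span {ev 1, ev 2, ecov 1, ecov 2, emat 1 3, emat 2 3, emat 3 1, emat 3 2}"

definition l_alg :: "gvec set" where
  "l_alg = {H + X | H X. H \<in> cartan \<and>
     X \<in> span {ev 1, ecov 2, ecov 3, emat 1 2, emat 1 3, emat 2 3}}"

definition l_basis :: "gvec list" where
  "l_basis =
     [(- 3) *\<^sub>R emat 1 3,
      (1 / 2) *\<^sub>R (emat 1 1 - emat 3 3),
      (1 / sqrt 3) *\<^sub>R ecov 2,
      (1 / (2 * sqrt 3)) *\<^sub>R (emat 1 1 - 2 *\<^sub>R emat 2 2 + emat 3 3),
      sqrt 3 *\<^sub>R emat 2 3,
      ecov 3,
      (- sqrt 3) *\<^sub>R emat 1 2,
      - ev 1]"


section \<open>Lie groups with this Lie algebra\<close>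

text \<open>\<open>\<Phi>\<close> identifies the Lie algebra above with the Lie algebra of \<open>G\<close> (left-invariant fields).\<close>

definition lie_algebra_identification ::
    "('a, 'e::euclidean_space) lie_group_struct \<Rightarrow> (gvec \<Rightarrow> 'a \<Rightarrow> 'a tangent) \<Rightarrow> bool" where
  "lie_algebra_identification G \<Phi> \<longleftrightarrow>
     bij_betw \<Phi> g2 (left_invariant_fields G) \<and>
     (\<forall>X\<in>g2. \<forall>Y\<in>g2. \<forall>a b. \<Phi> (a *\<^sub>R X + b *\<^sub>R Y) = (\<lambda>p f. a * \<Phi> X p f + b * \<Phi> Y p f)) \<and>
     (\<forall>X\<in>g2. \<forall>Y\<in>g2. \<Phi> (g2_bracket X Y) = vf_bracket (lg_man G) (\<Phi> X) (\<Phi> Y))"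

definition connected_lie_subgroup ::
    "('a, 'e::euclidean_space) lie_group_struct \<Rightarrow> (gvec \<Rightarrow> 'a \<Rightarrow> 'a tangent) \<Rightarrow>
     ('a, 'f::euclidean_space) lie_group_struct \<Rightarrow> gvec set \<Rightarrow> bool" where
  "connected_lie_subgroup G \<Phi> H h \<longleftrightarrow>
     lie_subgroup H G \<and> connected_space (man_top (lg_man H)) \<and>
     differential (lg_man G) (\<lambda>x. x) ` tangent_space (lg_man H) \<one>\<^bsub>H\<^esub> = (\<lambda>X. \<Phi> X \<one>\<^bsub>G\<^esub>) ` h"

text \<open>The tangent vector of the subgroup \<open>H\<close> at the identity that corresponds to \<open>X\<close>.\<close>

definition sub_tangent ::
    "('a, 'e::euclidean_space) lie_group_struct \<Rightarrow> (gvec \<Rightarrow> 'a \<Rightarrow> 'a tangent) \<Rightarrow>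
     ('a, 'f::euclidean_space) lie_group_struct \<Rightarrow> gvec \<Rightarrow> 'a tangent" where
  "sub_tangent G \<Phi> H X =
     inv_into (tangent_space (lg_man H) \<one>\<^bsub>H\<^esub>) (differential (lg_man G) (\<lambda>x. x)) (\<Phi> X \<one>\<^bsub>G\<^esub>)"

definition gram_diag ::
    "('a, 'e::euclidean_space) lie_group_struct \<Rightarrow> (gvec \<Rightarrow> 'a \<Rightarrow> 'a tangent) \<Rightarrow>
     ('a, 'f::euclidean_space) lie_group_struct \<Rightarrow> 'a metric_tensor \<Rightarrow> real list \<Rightarrow> bool" where
  "gram_diag G \<Phi> L g d \<longleftrightarrow>
     (\<forall>i<8. \<forall>j<8. g \<one>\<^bsub>L\<^esub> (sub_tangent G \<Phi> L (l_basis ! i)) (sub_tangent G \<Phi> L (l_basis ! j))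
        = (if i = j then d ! i / 4 else 0))"

text \<open>The base point \<open>o\<close> of \<open>G/H\<close> is the coset \<open>H\<close> itself.\<close>

definition is_gS ::
    "('a, 'e::euclidean_space) lie_group_struct \<Rightarrow> (gvec \<Rightarrow> 'a \<Rightarrow> 'a tangent) \<Rightarrow> 'a set \<Rightarrow>
     ('a set, 's::euclidean_space) manifold \<Rightarrow> 'a set metric_tensor \<Rightarrow> bool" where
  "is_gS G \<Phi> H S g \<longleftrightarrow>
     pseudo_riemannian_metric S g \<and>
     (\<forall>a\<in>carrier G. metric_eq S (pullback_metric S (\<lambda>C. a <#\<^bsub>G\<^esub> C) g) g) \<and>
     (\<forall>X\<in>g_odd. \<forall>Y\<in>g_odd.
        g H (differential S (\<lambda>x. x <#\<^bsub>G\<^esub> H) (\<Phi> X \<one>\<^bsub>G\<^esub>)) (differential S (\<lambda>x. x <#\<^bsub>G\<^esub> H) (\<Phi> Y \<one>\<^bsub>G\<^esub>))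
          = killing X Y / 8)"

definition conj_orbit ::
    "('a, 'e) lie_group_struct \<Rightarrow> 'a set \<Rightarrow> 'a \<Rightarrow> 'a \<Rightarrow> 'a set" where
  "conj_orbit G H a = (\<lambda>x. (a \<otimes>\<^bsub>G\<^esub> x \<otimes>\<^bsub>G\<^esub> inv\<^bsub>G\<^esub> a) <#\<^bsub>G\<^esub> H)"

end

theory Submission
  imports Defs
begin

text \<open>
  The differential at the identity of an automorphism of \<open>L\<close> intertwines the adjoint actions; since
  the derivative of \<open>Ad\<close> is \<open>ad\<close>, it induces an automorphism of the Lie algebra of \<open>L\<close>. That Lie
  algebra has exactly one one-dimensional ideal, the highest root space spanned by \<open>\<V>\<^sub>1\<close>, so
  \<open>\<V>\<^sub>1\<close> is mapped to a multiple of itself and the sign of its square norm is an invariant. This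
  sign is negative for \<open>g\<^bsup>(TS)\<^esup>\<close> and positive for \<open>g\<^bsup>(ST)\<^esup>\<close>. For \<open>g\<^sub>1\<close> and \<open>g\<^sub>2\<close> the square norm of
  \<open>\<V>\<^sub>1\<close> is an eighth of the Killing square norm of the odd part of \<open>Ad(a\<^sub>i) \<V>\<^sub>1 = exp (ad Y\<^sub>i) \<V>\<^sub>1\<close>,
  that is \<open>-144/8\<close> and \<open>576/8\<close>.
\<close>

section \<open>Calculus of smooth functions\<close>

text \<open>The differential of an automorphism multiplies V_1 by some c, hence its square norm by
  c^2, which cannot turn a negative number into a positive one. The obstacle is the bracket of L.
  The map \<open>\<Phi>\<close> names left-invariant fields of G, while L has a smooth structure of
  its own and is merely immersed: a smooth function on L need not extend to G, so
  \<open>\<Phi>\<close> gives no direct access to fields on L. Conjugation avoids such fields, since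
  it acts on the tangent space at the identity and commutes with the inclusion of L into G. Tangent
  vectors are functionals on smooth functions, so a curve of them is at first differentiable only
  one test function at a time. As \<open>l_alg\<close> has finite dimension, this already yields a
  derivative in \<open>l_alg\<close>, and from there every smooth function on L can be
  tested.\<close>

lemma frechet_derivative_eqI:
  "(f has_derivative f') (at x) \<Longrightarrow> frechet_derivative f (at x) = f'"
  using frechet_derivative_at by metis

lemma has_derivative_frechet:
  "f differentiable at x \<Longrightarrow> (f has_derivative frechet_derivative f (at x)) (at x)"
  by (simp add: frechet_derivative_works)

text \<open>\<open>Ck_on\<close> takes derivatives in the full space, so it is agreement on an open
  set that carries over to every derivative.\<close>

lemma Ck_on_cong_imp:
  assumes "open S" "\<And>x. x \<in> S \<Longrightarrow> f x = g x" "Ck_on k S f"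
  shows "Ck_on k S g"
  using assms(2,3)
proof (induction k arbitrary: f g)
  case 0
  then show ?case using continuous_on_cong by force
next
  case (Suc k)
  have D: "(g has_derivative frechet_derivative f (at x)) (at x)" if "x \<in> S" for x
    using has_derivative_transform_within_open[OF has_derivative_frechet \<open>open S\<close> that, of f g]
      Suc.prems that by auto
  have "Ck_on k S (\<lambda>x. frechet_derivative g (at x) v)" for v
    by (rule Suc.IH[of "\<lambda>x. frechet_derivative f (at x) v"])
      (use Suc.prems in \<open>auto simp: frechet_derivative_eqI[OF D]\<close>)
  then show ?case using D unfolding Ck_on.simps differentiable_def by blast
qed

lemma Ck_on_subset: "Ck_on k S f \<Longrightarrow> T \<subseteq> S \<Longrightarrow> Ck_on k T f"
  by (induction k arbitrary: f) (auto intro: continuous_on_subset)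

text \<open>Needed because a composition of smooth maps passes through an intermediate chart that
  varies from point to point.\<close>

lemma Ck_on_local:
  assumes "\<And>x. x \<in> S \<Longrightarrow> \<exists>T. open T \<and> x \<in> T \<and> Ck_on k T f"
  shows "Ck_on k S f"
  using assms
proof (induction k arbitrary: f)
  case 0
  have "continuous (at x within S) f" if x: "x \<in> S" for x
    using 0[OF x] by (auto intro: continuous_at_imp_continuous_within simp: continuous_on_eq_continuous_at)
  then show ?case by (auto simp: continuous_on_eq_continuous_within)
next
  case (Suc k)
  have "Ck_on k S (\<lambda>x. frechet_derivative f (at x) v)" for v
    by (rule Suc.IH) (use Suc.prems in force)
  moreover have "f differentiable at x" if "x \<in> S" for x
    using Suc.prems[OF that] by auto
  ultimately show ?case by simp
qed

lemma Ck_on_Suc_imp: "Ck_on (Suc k) S f \<Longrightarrow> Ck_on k S f"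
proof (induction k arbitrary: f)
  case 0
  then show ?case
    by (auto intro!: continuous_at_imp_continuous_on differentiable_imp_continuous_within)
next
  case (Suc k)
  then show ?case unfolding Ck_on.simps(2)[of "Suc k"] by auto
qed

lemma Ck_on_const: "Ck_on k S (\<lambda>x. c)"
proof (induction k arbitrary: c)
  case (Suc k)
  have "frechet_derivative (\<lambda>x. c) (at x) = (\<lambda>v. 0)" for x :: 'a
    by (rule frechet_derivative_eqI) simp
  with Suc show ?case by simp
qed simp

lemma Ck_on_linear_compose:
  assumes "open S" "bounded_linear h" "Ck_on k S f"
  shows "Ck_on k S (\<lambda>x. h (f x))"
  using assms(3)
proof (induction k arbitrary: f)
  case 0
  then show ?case by (auto intro: bounded_linear.continuous_on[OF assms(2)])
next
  case (Suc k)
  have D: "((\<lambda>x. h (f x)) has_derivative (\<lambda>v. h (frechet_derivative f (at x) v))) (at x)"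
    if "x \<in> S" for x
    using Suc.prems that bounded_linear.has_derivative[OF assms(2) has_derivative_frechet] by auto
  have "Ck_on k S (\<lambda>x. frechet_derivative (\<lambda>x. h (f x)) (at x) v)" for v
    by (rule Ck_on_cong_imp[OF \<open>open S\<close> _ Suc.IH[of "\<lambda>x. frechet_derivative f (at x) v"]])
      (use Suc.prems in \<open>auto simp: frechet_derivative_eqI[OF D]\<close>)
  then show ?case using D unfolding Ck_on.simps differentiable_def by blast
qed

lemma Ck_on_add:
  assumes "open S" "Ck_on k S f" "Ck_on k S g"
  shows "Ck_on k S (\<lambda>x. f x + g x)"
  using assms(2,3)
proof (induction k arbitrary: f g)
  case 0
  then show ?case by (auto intro: continuous_intros)
next
  case (Suc k)
  have D: "((\<lambda>x. f x + g x) has_derivative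
      (\<lambda>v. frechet_derivative f (at x) v + frechet_derivative g (at x) v)) (at x)"
    if "x \<in> S" for x
    using Suc.prems that by (auto intro!: has_derivative_add has_derivative_frechet)
  have "Ck_on k S (\<lambda>x. frechet_derivative (\<lambda>x. f x + g x) (at x) v)" for v
    by (rule Ck_on_cong_imp[OF \<open>open S\<close> _ Suc.IH[of "\<lambda>x. frechet_derivative f (at x) v"
          "\<lambda>x. frechet_derivative g (at x) v"]])
      (use Suc.prems in \<open>auto simp: frechet_derivative_eqI[OF D]\<close>)
  then show ?case using D unfolding Ck_on.simps differentiable_def by blast
qed

lemma Ck_on_sum:
  assumes "open S" "\<And>i. i \<in> I \<Longrightarrow> Ck_on k S (f i)"
  shows "Ck_on k S (\<lambda>x. \<Sum>i\<in>I. f i x)"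
  using assms(2)
  by (induction I rule: infinite_finite_induct) (auto intro: Ck_on_const Ck_on_add[OF \<open>open S\<close>])

lemma Ck_on_scaleR:
  fixes f :: "'a::real_normed_vector \<Rightarrow> real"
  assumes "open S" "Ck_on k S f" "Ck_on k S g"
  shows "Ck_on k S (\<lambda>x. f x *\<^sub>R g x)"
  using assms(2,3)
proof (induction k arbitrary: f g)
  case 0
  then show ?case by (auto intro: continuous_intros)
next
  case (Suc k)
  have D: "((\<lambda>x. f x *\<^sub>R g x) has_derivative
      (\<lambda>v. f x *\<^sub>R frechet_derivative g (at x) v + frechet_derivative f (at x) v *\<^sub>R g x)) (at x)"
    if "x \<in> S" for x
    using Suc.prems that by (auto intro!: has_derivative_scaleR has_derivative_frechet)
  have "Ck_on k S (\<lambda>x. frechet_derivative (\<lambda>x. f x *\<^sub>R g x) (at x) v)" for v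
  proof (rule Ck_on_cong_imp[OF \<open>open S\<close>])
    show "Ck_on k S (\<lambda>x. f x *\<^sub>R frechet_derivative g (at x) v + frechet_derivative f (at x) v *\<^sub>R g x)"
      \<comment> \<open>The product rule leaves one factor undifferentiated in each summand, so
        \<open>f\<close> and \<open>g\<close> themselves are needed at the lower order
        \<open>k\<close>.\<close>
      using Suc.prems Suc.prems[THEN Ck_on_Suc_imp]
      by (intro Ck_on_add[OF \<open>open S\<close>] Suc.IH) auto
  qed (auto simp: frechet_derivative_eqI[OF D])
  then show ?case using D unfolding Ck_on.simps differentiable_def by blast
qed

lemma smooth_on_derivative:
  "smooth_on S f \<Longrightarrow> smooth_on S (\<lambda>x. frechet_derivative f (at x) v)"
  unfolding smooth_on_def using Ck_on.simps(2) by blast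

lemma smooth_on_differentiable: "smooth_on S f \<Longrightarrow> x \<in> S \<Longrightarrow> f differentiable at x"
  unfolding smooth_on_def using Ck_on.simps(2) by blast

lemma smooth_on_continuous: "smooth_on S f \<Longrightarrow> continuous_on S f"
  unfolding smooth_on_def using Ck_on.simps(1) by blast

lemma smooth_on_cong:
  assumes "open S" "\<And>x. x \<in> S \<Longrightarrow> f x = g x"
  shows "smooth_on S f \<longleftrightarrow> smooth_on S g"
  unfolding smooth_on_def using Ck_on_cong_imp[OF assms(1)] assms(2) by metis

lemma smooth_on_subset: "smooth_on S f \<Longrightarrow> T \<subseteq> S \<Longrightarrow> smooth_on T f"
  unfolding smooth_on_def using Ck_on_subset by blast

lemma smooth_on_local:
  assumes "\<And>x. x \<in> S \<Longrightarrow> \<exists>T. open T \<and> x \<in> T \<and> smooth_on T f"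
  shows "smooth_on S f"
  unfolding smooth_on_def by (intro allI Ck_on_local) (use assms smooth_on_def in blast)

lemma smooth_on_const: "smooth_on S (\<lambda>x. c)"
  by (simp add: smooth_on_def Ck_on_const)

lemma smooth_on_linear_compose:
  "open S \<Longrightarrow> bounded_linear h \<Longrightarrow> smooth_on S f \<Longrightarrow> smooth_on S (\<lambda>x. h (f x))"
  by (simp add: smooth_on_def Ck_on_linear_compose)

lemma smooth_on_add:
  "open S \<Longrightarrow> smooth_on S f \<Longrightarrow> smooth_on S g \<Longrightarrow> smooth_on S (\<lambda>x. f x + g x)"
  by (simp add: smooth_on_def Ck_on_add)

lemma smooth_on_linear:
  assumes "bounded_linear f"
  shows "smooth_on S f"
proof -
  have D: "(f has_derivative f) (at x)" for x
    using assms by (rule bounded_linear_imp_has_derivative)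
  have "Ck_on k S f" for k
    by (cases k) (use D in \<open>auto simp: frechet_derivative_eqI[OF D] Ck_on_const differentiable_def
        intro: linear_continuous_on[OF assms]\<close>)
  then show ?thesis by (simp add: smooth_on_def)
qed

lemma smooth_on_Pair:
  assumes "open S" "smooth_on S f" "smooth_on S g"
  shows "smooth_on S (\<lambda>x. (f x, g x))"
proof -
  have "smooth_on S (\<lambda>x. (f x, 0) + (0, g x))"
    by (intro smooth_on_add assms smooth_on_linear_compose[where f=f] smooth_on_linear_compose[where f=g]
        bounded_linear_intros)
  then show ?thesis by simp
qed

text \<open>Expanding the chain rule in \<open>Basis\<close> writes each derivative of the
  composition as a sum of real coefficients coming from \<open>g\<close> times directional
  derivatives of \<open>f\<close> evaluated at \<open>g x\<close>. Those derivatives are again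
  smooth functions composed with \<open>g\<close>, so the induction runs over all smooth
  \<open>f\<close> while \<open>g\<close> stays fixed, and no formula for higher derivatives is
  required.\<close>

lemma smooth_on_compose:
  fixes g :: "'a::real_normed_vector \<Rightarrow> 'b::euclidean_space"
  assumes "open S" "open T" "smooth_on S g" "smooth_on T f" "g ` S \<subseteq> T"
  shows "smooth_on S (\<lambda>x. f (g x))"
proof -
  have "Ck_on k S (\<lambda>x. f (g x))" for k
    using assms(4)
  proof (induction k arbitrary: f)
    case 0
    have "continuous_on (g ` S) f"
      using smooth_on_continuous[OF 0] assms(5) continuous_on_subset by blast
    then show ?case
      using continuous_on_compose2[of "g ` S" f S g] smooth_on_continuous[OF assms(3)] by auto
  next
    case (Suc k)
    have D: "((\<lambda>x. f (g x)) has_derivative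
        (\<lambda>v. \<Sum>b\<in>Basis. (frechet_derivative g (at x) v \<bullet> b) *\<^sub>R frechet_derivative f (at (g x)) b)) (at x)"
      if "x \<in> S" for x
    proof -
      have f: "(f has_derivative frechet_derivative f (at (g x))) (at (g x))"
        using assms(5) that smooth_on_differentiable[OF Suc.prems]
        by (intro has_derivative_frechet) auto
      have g: "(g has_derivative frechet_derivative g (at x)) (at x)"
        using that smooth_on_differentiable[OF assms(3)] by (intro has_derivative_frechet)
      interpret f': linear "frechet_derivative f (at (g x))"
        using f has_derivative_linear by blast
      have "frechet_derivative f (at (g x)) (frechet_derivative g (at x) v) =
         (\<Sum>b\<in>Basis. (frechet_derivative g (at x) v \<bullet> b) *\<^sub>R frechet_derivative f (at (g x)) b)" for v
        by (subst (1) euclidean_representation[symmetric]) (simp only: f'.sum f'.scale)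
      then show ?thesis using has_derivative_compose[OF g f] by simp
    qed
    have "Ck_on k S (\<lambda>x. frechet_derivative (\<lambda>x. f (g x)) (at x) v)" for v
    proof (rule Ck_on_cong_imp[OF \<open>open S\<close>])
      show "Ck_on k S (\<lambda>x. \<Sum>b\<in>Basis. (frechet_derivative g (at x) v \<bullet> b) *\<^sub>R
          frechet_derivative f (at (g x)) b)"
      proof (intro Ck_on_sum Ck_on_scaleR \<open>open S\<close> Suc.IH smooth_on_derivative Suc.prems)
        show "Ck_on k S (\<lambda>x. frechet_derivative g (at x) v \<bullet> b)" for b
          by (rule Ck_on_linear_compose[OF \<open>open S\<close> bounded_linear_inner_left])
            (use assms(3) smooth_on_derivative smooth_on_def in blast)
      qed
    qed (auto simp: frechet_derivative_eqI[OF D])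
    then show ?case using D unfolding Ck_on.simps differentiable_def by blast
  qed
  then show ?thesis by (simp add: smooth_on_def)
qed

lemma smooth_on_deriv:
  fixes f :: "real \<Rightarrow> real"
  assumes "smooth_on UNIV f"
  shows "(f has_real_derivative deriv f t) (at t)"
  using smooth_on_differentiable[OF assms] by (simp add: DERIV_deriv_iff_real_differentiable)

section \<open>Partial derivatives in two variables and their symmetry\<close>

lemma has_partial_deriv_2:
  fixes K :: "'a::real_normed_vector \<times> real \<Rightarrow> real"
  assumes "K differentiable at (x, s)"
  shows "((\<lambda>s. K (x, s)) has_real_derivative frechet_derivative K (at (x, s)) (0, 1)) (at s)"
proof -
  have K: "(K has_derivative frechet_derivative K (at (x, s))) (at (x, s))"
    using assms by (rule has_derivative_frechet)
  interpret K': linear "frechet_derivative K (at (x, s))"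
    using K has_derivative_linear by blast
  have "((\<lambda>s. (x, s)) has_derivative (\<lambda>v. (0, v))) (at s)"
    by (intro has_derivative_Pair has_derivative_const has_derivative_ident)
  from has_derivative_compose[OF this K]
  have "((\<lambda>s. K (x, s)) has_derivative (\<lambda>v. frechet_derivative K (at (x, s)) (0, v))) (at s)" .
  moreover have "(\<lambda>v. frechet_derivative K (at (x, s)) (0, v)) = (*) (frechet_derivative K (at (x, s)) (0, 1))"
  proof
    show "frechet_derivative K (at (x, s)) (0, v) = frechet_derivative K (at (x, s)) (0, 1) * v" for v
      using K'.scale[of v "(0, 1)"] by simp
  qed
  ultimately show ?thesis by (simp only: has_field_derivative_def)
qed

lemma has_partial_deriv_1:
  fixes K :: "real \<times> real \<Rightarrow> real"
  assumes "K differentiable at (t, s)"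
  shows "((\<lambda>t. K (t, s)) has_real_derivative frechet_derivative K (at (t, s)) (1, 0)) (at t)"
proof -
  have K: "(K has_derivative frechet_derivative K (at (t, s))) (at (t, s))"
    using assms by (rule has_derivative_frechet)
  interpret K': linear "frechet_derivative K (at (t, s))"
    using K has_derivative_linear by blast
  have "((\<lambda>t. (t, s)) has_derivative (\<lambda>v. (v, 0))) (at t)"
    by (intro has_derivative_Pair has_derivative_const has_derivative_ident)
  from has_derivative_compose[OF this K]
  have "((\<lambda>t. K (t, s)) has_derivative (\<lambda>v. frechet_derivative K (at (t, s)) (v, 0))) (at t)" .
  moreover have "(\<lambda>v. frechet_derivative K (at (t, s)) (v, 0)) = (*) (frechet_derivative K (at (t, s)) (1, 0))"
  proof
    show "frechet_derivative K (at (t, s)) (v, 0) = frechet_derivative K (at (t, s)) (1, 0) * v" for v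
      using K'.scale[of v "(1, 0)"] by simp
  qed
  ultimately show ?thesis by (simp only: has_field_derivative_def)
qed

text \<open>The direction (v, v) is (v, 0) + (0, v). For a function of the product of two curves in
  a Lie group this becomes the product rule.\<close>

lemma deriv_diagonal:
  fixes K :: "real \<times> real \<Rightarrow> real"
  assumes "K differentiable at (t, t)"
  shows "deriv (\<lambda>r. K (r, r)) t = deriv (\<lambda>r. K (r, t)) t + deriv (\<lambda>r. K (t, r)) t"
proof -
  have K: "(K has_derivative frechet_derivative K (at (t, t))) (at (t, t))"
    using assms by (rule has_derivative_frechet)
  interpret K': linear "frechet_derivative K (at (t, t))"
    using K has_derivative_linear by blast
  have "((\<lambda>r. (r, r)) has_derivative (\<lambda>v. (v, v))) (at t)"
    by (intro has_derivative_Pair has_derivative_const has_derivative_ident)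
  from has_derivative_compose[OF this K]
  have "((\<lambda>r. K (r, r)) has_derivative (\<lambda>v. frechet_derivative K (at (t, t)) (v, v))) (at t)" .
  moreover have "(\<lambda>v. frechet_derivative K (at (t, t)) (v, v)) =
     (*) (frechet_derivative K (at (t, t)) (1, 0) + frechet_derivative K (at (t, t)) (0, 1))"
  proof
    fix v :: real
    have "frechet_derivative K (at (t, t)) (v, v) = v * frechet_derivative K (at (t, t)) ((1, 0) + (0, 1))"
      using K'.scale[of v "(1, 1)"] by simp
    also have "\<dots> = (frechet_derivative K (at (t, t)) (1, 0) + frechet_derivative K (at (t, t)) (0, 1)) * v"
      by (simp only: K'.add mult.commute)
    finally show "frechet_derivative K (at (t, t)) (v, v) =
      (frechet_derivative K (at (t, t)) (1, 0) + frechet_derivative K (at (t, t)) (0, 1)) * v" .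
  qed
  ultimately have "((\<lambda>r. K (r, r)) has_real_derivative frechet_derivative K (at (t, t)) (1, 0) +
     frechet_derivative K (at (t, t)) (0, 1)) (at t)"
    by (simp only: has_field_derivative_def)
  then show ?thesis
    using has_partial_deriv_2[OF assms] has_partial_deriv_1[OF assms] by (simp add: DERIV_imp_deriv)
qed

text \<open>The mean value theorem is used twice: in \<open>t\<close> for the difference of the rows
  at \<open>h\<close> and 0, then in \<open>s\<close>. The second difference is symmetric in the two
  variables, so it can be compared with either mixed partial.\<close>

lemma second_difference_mean_value:
  fixes H :: "real \<Rightarrow> real \<Rightarrow> real"
  assumes "\<And>t s. ((\<lambda>t. H t s) has_real_derivative A t s) (at t)"
    and "\<And>t s. (A t has_real_derivative B t s) (at s)" and "h > 0"
  shows "\<exists>t s. 0 < t \<and> t < h \<and> 0 < s \<and> s < h \<and> H h h - H h 0 - H 0 h + H 0 0 = h * h * B t s"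
proof -
  have "((\<lambda>t. H t h - H t 0) has_real_derivative A t h - A t 0) (at t)" for t
    by (intro DERIV_diff assms)
  from MVT2[OF \<open>h > 0\<close> this] obtain t where t: "0 < t" "t < h"
      "(H h h - H h 0) - (H 0 h - H 0 0) = (h - 0) * (A t h - A t 0)" by blast
  from MVT2[OF \<open>h > 0\<close> assms(2)] obtain s where "0 < s" "s < h" "A t h - A t 0 = (h - 0) * B t s"
    by blast
  with t show ?thesis by (intro exI[of _ t] exI[of _ s]) (auto simp: algebra_simps)
qed

lemma mixed_partials_commute:
  fixes K :: "real \<times> real \<Rightarrow> real"
  assumes K: "smooth_on UNIV K"
  shows "deriv (\<lambda>s. deriv (\<lambda>t. K (t, s)) 0) 0 = deriv (\<lambda>t. deriv (\<lambda>s. K (t, s)) 0) 0"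
proof -
  define A where "A = (\<lambda>p. frechet_derivative K (at p) (1, 0))"
  define B where "B = (\<lambda>p. frechet_derivative K (at p) (0, 1))"
  define AB where "AB = (\<lambda>p. frechet_derivative A (at p) (0, 1))"
  define BA where "BA = (\<lambda>p. frechet_derivative B (at p) (1, 0))"
  have sA: "smooth_on UNIV A" and sB: "smooth_on UNIV B"
    unfolding A_def B_def by (intro smooth_on_derivative K)+
  have sAB: "smooth_on UNIV AB" and sBA: "smooth_on UNIV BA"
    unfolding AB_def BA_def by (intro smooth_on_derivative sA sB)+
  have dA: "((\<lambda>t. K (t, s)) has_real_derivative A (t, s)) (at t)" for t s
    unfolding A_def using smooth_on_differentiable[OF K] by (intro has_partial_deriv_1) auto
  have dB: "((\<lambda>s. K (t, s)) has_real_derivative B (t, s)) (at s)" for t s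
    unfolding B_def using smooth_on_differentiable[OF K] by (intro has_partial_deriv_2) auto
  have dAB: "((\<lambda>s. A (t, s)) has_real_derivative AB (t, s)) (at s)" for t s
    unfolding AB_def using smooth_on_differentiable[OF sA] by (intro has_partial_deriv_2) auto
  have dBA: "((\<lambda>t. B (t, s)) has_real_derivative BA (t, s)) (at t)" for t s
    unfolding BA_def using smooth_on_differentiable[OF sB] by (intro has_partial_deriv_1) auto
  have near: "dist (t, s) (0, 0) < 2 * h" if "0 < t" "t < h" "0 < s" "s < h" for t s h :: real
  proof -
    have "dist (t, s) (0, 0) \<le> \<bar>t\<bar> + \<bar>s\<bar>"
      unfolding dist_norm using norm_Pair_le[of t s] by simp
    with that show ?thesis by simp
  qed
  have "AB (0, 0) = BA (0, 0)"
  proof (rule ccontr)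
    \<comment> \<open>With half of the distance, values closer than \<open>e\<close> to the
      respective ends cannot coincide.\<close>
    define e where "e = dist (AB (0, 0)) (BA (0, 0)) / 2"
    assume "AB (0, 0) \<noteq> BA (0, 0)"
    then have "e > 0" by (simp add: e_def)
    have "isCont AB (0, 0)" "isCont BA (0, 0)"
      using smooth_on_continuous[OF sAB] smooth_on_continuous[OF sBA]
      by (auto simp: continuous_on_eq_continuous_at)
    then obtain d1 d2 where d: "d1 > 0" "d2 > 0"
      "\<And>p. dist p (0, 0) < d1 \<Longrightarrow> dist (AB p) (AB (0, 0)) < e"
      "\<And>p. dist p (0, 0) < d2 \<Longrightarrow> dist (BA p) (BA (0, 0)) < e"
      unfolding continuous_at_eps_delta using \<open>e > 0\<close> by metis
    \<comment> \<open>By \<open>near\<close>, points of the open square of side \<open>h\<close> lie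
      within \<open>2 * h\<close> of the origin.\<close>
    define h where "h = min d1 d2 / 2"
    have "h > 0" using d by (simp add: h_def)
    from second_difference_mean_value[of "\<lambda>t s. K (t, s)", OF dA dAB this]
    obtain t s where ts: "0 < t" "t < h" "0 < s" "s < h"
      "K (h, h) - K (h, 0) - K (0, h) + K (0, 0) = h * h * AB (t, s)" by blast
    from second_difference_mean_value[of "\<lambda>s t. K (t, s)", OF dB dBA \<open>h > 0\<close>]
    obtain t' s' where ts': "0 < t'" "t' < h" "0 < s'" "s' < h"
      "K (h, h) - K (0, h) - K (h, 0) + K (0, 0) = h * h * BA (t', s')" by blast
    have "h * h * AB (t, s) = h * h * BA (t', s')" using ts(5) ts'(5) by linarith
    then have "AB (t, s) = BA (t', s')" using \<open>h > 0\<close> by simp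
    moreover have "dist (AB (t, s)) (AB (0, 0)) < e" "dist (BA (t', s')) (BA (0, 0)) < e"
      using near[OF ts(1-4)] near[OF ts'(1-4)] by (auto intro!: d(3,4) simp: h_def)
    ultimately show False
      unfolding e_def by (smt (verit) dist_commute dist_triangle field_sum_of_halves)
  qed
  moreover have "deriv (\<lambda>t. K (t, s)) 0 = A (0, s)" "deriv (\<lambda>s. K (t, s)) 0 = B (t, 0)" for t s
    using dA dB by (simp_all add: DERIV_imp_deriv)
  moreover have "deriv (\<lambda>s. A (0, s)) 0 = AB (0, 0)" "deriv (\<lambda>t. B (t, 0)) 0 = BA (0, 0)"
    using dAB dBA by (simp_all add: DERIV_imp_deriv)
  ultimately show ?thesis by simp
qed

section \<open>Smooth maps and tangent vectors\<close>

text \<open>The fragment of \<open>smooth_manifold\<close> on which calculus in charts rests. It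
  passes to products, so multiplication on the product of a Lie group with itself can be treated by
  the same lemmas.\<close>

definition charted :: "('a, 'e::euclidean_space) manifold \<Rightarrow> bool" where
  "charted M \<longleftrightarrow> man_space M = (\<Union>(U, \<phi>)\<in>man_atlas M. U) \<and>
     (\<forall>(U, \<phi>)\<in>man_atlas M. openin (man_top M) U \<and> inj_on \<phi> U \<and>
        (\<forall>W. openin (man_top M) W \<and> W \<subseteq> U \<longrightarrow> open (\<phi> ` W)))"

lemma chart_openin: "charted M \<Longrightarrow> (U, \<phi>) \<in> man_atlas M \<Longrightarrow> openin (man_top M) U"
  and chart_inj: "charted M \<Longrightarrow> (U, \<phi>) \<in> man_atlas M \<Longrightarrow> inj_on \<phi> U"
  and chart_open: "charted M \<Longrightarrow> (U, \<phi>) \<in> man_atlas M \<Longrightarrow> openin (man_top M) W \<Longrightarrow> W \<subseteq> U \<Longrightarrow> open (\<phi> ` W)"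
  by (auto simp: charted_def)

lemma chart_exists:
  assumes "charted M" "p \<in> man_space M"
  obtains U \<phi> where "(U, \<phi>) \<in> man_atlas M" "p \<in> U"
  using assms unfolding charted_def by auto

lemma chart_subset: "charted M \<Longrightarrow> (U, \<phi>) \<in> man_atlas M \<Longrightarrow> U \<subseteq> man_space M"
  using openin_subset chart_openin unfolding man_space_def by metis

lemma charted_smooth_manifold:
  assumes "smooth_manifold M"
  shows "charted M"
proof -
  have "openin (man_top M) U \<and> inj_on \<phi> U \<and>
      (\<forall>W. openin (man_top M) W \<and> W \<subseteq> U \<longrightarrow> open (\<phi> ` W))" if "(U, \<phi>) \<in> man_atlas M" for U \<phi>
  proof -
    have U: "openin (man_top M) U" "open (\<phi> ` U)"
      and h: "homeomorphic_map (subtopology (man_top M) U) (top_of_set (\<phi> ` U)) \<phi>"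
      using assms that unfolding smooth_manifold_def by auto
    have top: "topspace (subtopology (man_top M) U) = U"
      using openin_subset[OF U(1)] by auto
    have "open (\<phi> ` W)" if W: "openin (man_top M) W" "W \<subseteq> U" for W
    proof -
      have "openin (subtopology (man_top M) U) W"
        using W by (metis inf.absorb1 openin_subtopology)
      then have "openin (top_of_set (\<phi> ` U)) (\<phi> ` W)"
        using homeomorphic_imp_open_map[OF h] unfolding open_map_def by blast
      then show ?thesis using U(2) openin_open_eq by blast
    qed
    with U h top show ?thesis by (auto simp: homeomorphic_map_def dest: homeomorphic_imp_injective_map)
  qed
  then show ?thesis using assms unfolding charted_def smooth_manifold_def by auto
qed

lemma man_top_euclidean [simp]: "man_top euclidean_manifold = euclidean"
  and man_atlas_euclidean [simp]: "man_atlas euclidean_manifold = {(UNIV, \<lambda>x. x)}"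
  and man_space_euclidean [simp]: "man_space euclidean_manifold = UNIV"
  by (simp_all add: euclidean_manifold_def man_space_def)

lemma man_top_prod [simp]: "man_top (prod_manifold M N) = prod_topology (man_top M) (man_top N)"
  and man_atlas_prod: "man_atlas (prod_manifold M N) =
    {(U \<times> V, map_prod \<phi> \<psi>) | U \<phi> V \<psi>. (U, \<phi>) \<in> man_atlas M \<and> (V, \<psi>) \<in> man_atlas N}"
  and man_space_prod [simp]: "man_space (prod_manifold M N) = man_space M \<times> man_space N"
  by (simp_all add: prod_manifold_def man_space_def)

lemma inv_into_UNIV_ident [simp]: "inv_into UNIV (\<lambda>x. x) = (\<lambda>x. x)"
  using inv_id unfolding id_def .

lemma charted_euclidean [simp]: "charted euclidean_manifold"
  by (auto simp: charted_def)

lemma charted_prod: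
  assumes M: "charted M" and N: "charted N"
  shows "charted (prod_manifold M N)"
proof -
  have "openin (prod_topology (man_top M) (man_top N)) (U \<times> V) \<and> inj_on (map_prod \<phi> \<psi>) (U \<times> V) \<and>
     (\<forall>W. openin (prod_topology (man_top M) (man_top N)) W \<and> W \<subseteq> U \<times> V \<longrightarrow> open (map_prod \<phi> \<psi> ` W))"
    if c: "(U, \<phi>) \<in> man_atlas M" "(V, \<psi>) \<in> man_atlas N" for U \<phi> V \<psi>
  proof (intro conjI allI impI)
    show "openin (prod_topology (man_top M) (man_top N)) (U \<times> V)"
      using chart_openin[OF M c(1)] chart_openin[OF N c(2)] by (simp add: openin_prod_Times_iff)
    show "inj_on (map_prod \<phi> \<psi>) (U \<times> V)"
      using chart_inj[OF M c(1)] chart_inj[OF N c(2)] by (rule map_prod_inj_on)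
    fix W assume W: "openin (prod_topology (man_top M) (man_top N)) W \<and> W \<subseteq> U \<times> V"
    show "open (map_prod \<phi> \<psi> ` W)"
    \<comment> \<open>An open set of the product is covered by boxes, and a box goes to the product
      of two open chart images.\<close>
    proof (subst open_subopen, rule ballI)
      fix y assume "y \<in> map_prod \<phi> \<psi> ` W"
      then obtain a b where ab: "(a, b) \<in> W" "y = (\<phi> a, \<psi> b)" by auto
      then obtain A B where AB: "openin (man_top M) A" "openin (man_top N) B" "a \<in> A" "b \<in> B" "A \<times> B \<subseteq> W"
        using W unfolding openin_prod_topology_alt by metis
      have "A \<subseteq> U" "B \<subseteq> V" using AB(3-5) W by blast+
      then have "open (\<phi> ` A \<times> \<psi> ` B)"
        using AB chart_open[OF M c(1)] chart_open[OF N c(2)] by (intro open_Times) auto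
      moreover have "\<phi> ` A \<times> \<psi> ` B = map_prod \<phi> \<psi> ` (A \<times> B)"
        by (rule map_prod_surj_on[symmetric]) simp_all
      moreover have "y \<in> \<phi> ` A \<times> \<psi> ` B" using ab AB(3,4) W by auto
      ultimately show "\<exists>T. open T \<and> y \<in> T \<and> T \<subseteq> map_prod \<phi> \<psi> ` W"
        using image_mono[OF AB(5), of "map_prod \<phi> \<psi>"] by (intro exI[of _ "\<phi> ` A \<times> \<psi> ` B"]) auto
    qed
  qed
  moreover have "man_space M \<times> man_space N = (\<Union>(U, \<phi>)\<in>man_atlas (prod_manifold M N). U)"
  proof (intro equalityI subsetI)
    fix x assume "x \<in> man_space M \<times> man_space N"
    then obtain U \<phi> V \<psi> where "(U, \<phi>) \<in> man_atlas M" "fst x \<in> U" "(V, \<psi>) \<in> man_atlas N" "snd x \<in> V"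
      using chart_exists[OF M] chart_exists[OF N] by (metis mem_Times_iff)
    then have "(U \<times> V, map_prod \<phi> \<psi>) \<in> man_atlas (prod_manifold M N)" "x \<in> U \<times> V"
      by (auto simp: man_atlas_prod mem_Times_iff)
    then show "x \<in> (\<Union>(U, \<phi>)\<in>man_atlas (prod_manifold M N). U)" by blast
  qed (use chart_subset[OF M] chart_subset[OF N] in \<open>force simp: man_atlas_prod\<close>)
  ultimately show ?thesis
    unfolding charted_def man_space_prod man_top_prod by (auto simp: man_atlas_prod)
qed

lemma openin_chart_vimage:
  assumes "charted M" "charted N" "continuous_map (man_top M) (man_top N) F"
    and "(U, \<phi>) \<in> man_atlas M" "(V, \<psi>) \<in> man_atlas N"
  shows "openin (man_top M) (U \<inter> F -` V)"
proof -
  have "U \<inter> F -` V = U \<inter> {x \<in> topspace (man_top M). F x \<in> V}"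
    using openin_subset[OF chart_openin[OF assms(1,4)]] by auto
  then show ?thesis
    using openin_continuous_map_preimage[OF assms(3) chart_openin[OF assms(2,5)]]
      chart_openin[OF assms(1,4)] by auto
qed

lemma smooth_map_continuous: "smooth_map M N F \<Longrightarrow> continuous_map (man_top M) (man_top N) F"
  by (simp add: smooth_map_def)

lemma smooth_map_chart:
  "smooth_map M N F \<Longrightarrow> (U, \<phi>) \<in> man_atlas M \<Longrightarrow> (V, \<psi>) \<in> man_atlas N \<Longrightarrow>
    smooth_on (\<phi> ` (U \<inter> F -` V)) (\<psi> \<circ> F \<circ> inv_into U \<phi>)"
  unfolding smooth_map_def by blast

lemma smooth_map_in_space: "smooth_map M N F \<Longrightarrow> p \<in> man_space M \<Longrightarrow> F p \<in> man_space N"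
  unfolding smooth_map_def man_space_def continuous_map_def by blast

lemma smooth_map_compose:
  assumes M: "charted M" and N: "charted N" and P: "charted P"
    and F: "smooth_map M N F" and G: "smooth_map N P G"
  shows "smooth_map M P (\<lambda>x. G (F x))"
proof -
  have cont: "continuous_map (man_top M) (man_top P) (\<lambda>x. G (F x))"
    using continuous_map_compose[OF smooth_map_continuous[OF F] smooth_map_continuous[OF G]]
    by (simp add: o_def)
  have "smooth_on (\<phi> ` (U \<inter> (\<lambda>x. G (F x)) -` W)) (\<kappa> \<circ> (\<lambda>x. G (F x)) \<circ> inv_into U \<phi>)"
    if U: "(U, \<phi>) \<in> man_atlas M" and W: "(W, \<kappa>) \<in> man_atlas P" for U \<phi> W \<kappa>
  proof (rule smooth_on_local)
    fix x assume "x \<in> \<phi> ` (U \<inter> (\<lambda>x. G (F x)) -` W)"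
    then obtain m where m: "x = \<phi> m" "m \<in> U" "G (F m) \<in> W" by auto
    have "F m \<in> man_space N"
      using smooth_map_in_space[OF F] chart_subset[OF M U] m(2) by auto
    then obtain V \<psi> where V: "(V, \<psi>) \<in> man_atlas N" "F m \<in> V"
      using chart_exists[OF N] by blast
    \<comment> \<open>On these points the intermediate chart \<open>\<psi>\<close> and its inverse
      cancel, so the coordinate expression of the composition factors into two smooth ones.\<close>
    define D where "D = (U \<inter> F -` V) \<inter> (U \<inter> (\<lambda>x. G (F x)) -` W)"
    have D: "openin (man_top M) D"
      unfolding D_def
      by (intro openin_Int openin_chart_vimage[OF M N _ U V(1)] openin_chart_vimage[OF M P _ U W]
          cont smooth_map_continuous[OF F])
    then have oD: "open (\<phi> ` D)"
      by (rule chart_open[OF M U]) (auto simp: D_def)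
    have oE: "open (\<psi> ` (V \<inter> G -` W))"
      by (intro chart_open[OF N V(1)] openin_chart_vimage[OF N P _ V(1) W] smooth_map_continuous[OF G]) auto
    have inv: "inv_into U \<phi> (\<phi> z) = z" if "z \<in> U" for z
      using chart_inj[OF M U] that by simp
    have invV: "inv_into V \<psi> (\<psi> z) = z" if "z \<in> V" for z
      using chart_inj[OF N V(1)] that by simp
    have "smooth_on (\<phi> ` D) (\<lambda>y. (\<kappa> \<circ> G \<circ> inv_into V \<psi>) ((\<psi> \<circ> F \<circ> inv_into U \<phi>) y))"
    proof (rule smooth_on_compose[OF oD oE _ smooth_map_chart[OF G V(1) W]])
      show "smooth_on (\<phi> ` D) (\<psi> \<circ> F \<circ> inv_into U \<phi>)"
        by (rule smooth_on_subset[OF smooth_map_chart[OF F U V(1)]]) (auto simp: D_def)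
      show "(\<psi> \<circ> F \<circ> inv_into U \<phi>) ` \<phi> ` D \<subseteq> \<psi> ` (V \<inter> G -` W)"
        by (auto simp: D_def inv)
    qed
    then have "smooth_on (\<phi> ` D) (\<kappa> \<circ> (\<lambda>x. G (F x)) \<circ> inv_into U \<phi>)"
      by (rule smooth_on_cong[OF oD, THEN iffD1, rotated]) (auto simp: D_def inv invV)
    then show "\<exists>T. open T \<and> x \<in> T \<and> smooth_on T (\<kappa> \<circ> (\<lambda>x. G (F x)) \<circ> inv_into U \<phi>)"
      using oD m V(2) by (intro exI[of _ "\<phi> ` D"]) (auto simp: D_def)
  qed
  then show ?thesis using cont unfolding smooth_map_def by blast
qed

lemma smooth_map_Pair:
  assumes M: "charted M" and N: "charted N" and P: "charted P"
    and F: "smooth_map M N F" and G: "smooth_map M P G"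
  shows "smooth_map M (prod_manifold N P) (\<lambda>x. (F x, G x))"
proof -
  have cont: "continuous_map (man_top M) (man_top (prod_manifold N P)) (\<lambda>x. (F x, G x))"
    using smooth_map_continuous[OF F] smooth_map_continuous[OF G] by (simp add: continuous_map_pairedI)
  have "smooth_on (\<phi> ` (U \<inter> (\<lambda>x. (F x, G x)) -` (V \<times> W))) (map_prod \<psi> \<kappa> \<circ> (\<lambda>x. (F x, G x)) \<circ> inv_into U \<phi>)"
    if U: "(U, \<phi>) \<in> man_atlas M" and V: "(V, \<psi>) \<in> man_atlas N" and W: "(W, \<kappa>) \<in> man_atlas P"
    for U \<phi> V \<psi> W \<kappa>
  proof -
    define D where "D = (U \<inter> F -` V) \<inter> (U \<inter> G -` W)"
    have eq: "U \<inter> (\<lambda>x. (F x, G x)) -` (V \<times> W) = D" by (auto simp: D_def)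
    have "openin (man_top M) D"
      unfolding D_def
      by (intro openin_Int openin_chart_vimage[OF M N _ U V] openin_chart_vimage[OF M P _ U W]
          smooth_map_continuous[OF F] smooth_map_continuous[OF G])
    then have oD: "open (\<phi> ` D)"
      by (rule chart_open[OF M U]) (auto simp: D_def)
    have "smooth_on (\<phi> ` D) (\<lambda>y. ((\<psi> \<circ> F \<circ> inv_into U \<phi>) y, (\<kappa> \<circ> G \<circ> inv_into U \<phi>) y))"
      by (intro smooth_on_Pair oD smooth_on_subset[OF smooth_map_chart[OF F U V]]
          smooth_on_subset[OF smooth_map_chart[OF G U W]]) (auto simp: D_def)
    then show ?thesis unfolding eq by (simp add: o_def)
  qed
  then show ?thesis using cont unfolding smooth_map_def man_atlas_prod by auto
qed

lemma smooth_map_const: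
  assumes "p \<in> man_space N"
  shows "smooth_map M N (\<lambda>x. p)"
  using assms unfolding smooth_map_def man_space_def by (auto simp: o_def smooth_on_const)

lemma smooth_map_ident: "smooth_manifold M \<Longrightarrow> smooth_map M M (\<lambda>x. x)"
  unfolding smooth_map_def smooth_manifold_def by (auto simp: o_def)

lemma smooth_map_cong:
  assumes M: "charted M" and N: "charted N" and F: "smooth_map M N F"
    and eq: "\<And>x. x \<in> man_space M \<Longrightarrow> F x = G x"
  shows "smooth_map M N G"
proof -
  have "smooth_on (\<phi> ` (U \<inter> G -` V)) (\<psi> \<circ> G \<circ> inv_into U \<phi>)"
    if U: "(U, \<phi>) \<in> man_atlas M" and V: "(V, \<psi>) \<in> man_atlas N" for U \<phi> V \<psi>
  proof -
    have e: "F x = G x" if "x \<in> U" for x using eq chart_subset[OF M U] that by blast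
    then have s: "U \<inter> G -` V = U \<inter> F -` V" by auto
    have o: "open (\<phi> ` (U \<inter> F -` V))"
      by (intro chart_open[OF M U] openin_chart_vimage[OF M N _ U V] smooth_map_continuous[OF F]) auto
    show ?thesis unfolding s
      by (rule smooth_on_cong[OF o, THEN iffD1, OF _ smooth_map_chart[OF F U V]])
        (use e chart_inj[OF M U] in auto)
  qed
  moreover have "continuous_map (man_top M) (man_top N) G"
    using continuous_map_eq[OF smooth_map_continuous[OF F]] eq unfolding man_space_def by blast
  ultimately show ?thesis unfolding smooth_map_def by blast
qed

lemma smooth_map_euclidean_iff: "smooth_map euclidean_manifold euclidean_manifold f \<longleftrightarrow> smooth_on UNIV f"
  unfolding smooth_map_def by (auto simp: o_def smooth_on_continuous)

lemma smooth_functions_compose: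
  assumes "charted M" "charted N" "smooth_map M N F" "f \<in> smooth_functions N"
  shows "(\<lambda>x. f (F x)) \<in> smooth_functions M"
  using smooth_map_compose[OF assms(1,2) charted_euclidean assms(3)] assms(4)
  by (simp add: smooth_functions_def)

lemma smooth_functions_cong:
  assumes "charted M" "f \<in> smooth_functions M" "\<And>x. x \<in> man_space M \<Longrightarrow> f x = g x"
  shows "g \<in> smooth_functions M"
  using smooth_map_cong[OF assms(1) charted_euclidean] assms(2,3) by (auto simp: smooth_functions_def)

lemma smooth_function_curve:
  assumes "charted M" "smooth_map euclidean_manifold M c" "f \<in> smooth_functions M"
  shows "smooth_on UNIV (\<lambda>t. f (c t))"
  using smooth_functions_compose[OF charted_euclidean assms]
  by (simp add: smooth_functions_def smooth_map_euclidean_iff)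

section \<open>Tangent vectors and differentials through curves\<close>

lemma velocity_apply: "f \<in> smooth_functions M \<Longrightarrow> velocity M c f = deriv (\<lambda>t. f (c t)) 0"
  by (simp add: velocity_def o_def)

lemma differential_apply: "f \<in> smooth_functions N \<Longrightarrow> differential N F v f = v (\<lambda>x. f (F x))"
  by (simp add: differential_def o_def)

lemma differential_velocity:
  assumes "charted M" "charted N" "smooth_map M N F" "smooth_map euclidean_manifold M c"
  shows "differential N F (velocity M c) = velocity N (\<lambda>t. F (c t))"
proof
  fix f
  show "differential N F (velocity M c) f = velocity N (\<lambda>t. F (c t)) f"
    using smooth_functions_compose[OF assms(1-3)]
    by (cases "f \<in> smooth_functions N")
      (simp_all add: differential_apply velocity_apply, simp add: differential_def velocity_def)
qed

lemma tangent_spaceE: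
  assumes "v \<in> tangent_space M p"
  obtains c where "smooth_map euclidean_manifold M c" "c 0 = p" "v = velocity M c"
  using assms by (auto simp: tangent_space_def)

lemma velocity_tangent:
  "smooth_map euclidean_manifold M c \<Longrightarrow> velocity M c \<in> tangent_space M (c 0)"
  by (auto simp: tangent_space_def)

lemma differential_tangent:
  assumes "charted M" "charted N" "smooth_map M N F" "v \<in> tangent_space M p"
  shows "differential N F v \<in> tangent_space N (F p)"
  using assms(4)
proof (rule tangent_spaceE)
  fix c assume c: "smooth_map euclidean_manifold M c" "c 0 = p" "v = velocity M c"
  show ?thesis
    using differential_velocity[OF assms(1-3) c(1)] c
      velocity_tangent[OF smooth_map_compose[OF charted_euclidean assms(1-2) c(1) assms(3)]] by simp
qed

lemma differential_compose:
  assumes "charted N" "charted P" "smooth_map N P G"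
  shows "differential P G (differential N F v) = differential P (\<lambda>x. G (F x)) v"
  using smooth_functions_compose[OF assms] by (auto simp: differential_def o_def)

text \<open>Functions live on a whole type, whereas group laws hold only on the carrier. A tangent
  vector comes from a curve that stays in the manifold, so such laws may be used inside its
  argument.\<close>

lemma tangent_cong:
  assumes "charted M" "v \<in> tangent_space M p" "\<And>x. x \<in> man_space M \<Longrightarrow> f x = g x"
  shows "v f = v g"
  using assms(2)
proof (rule tangent_spaceE)
  fix c assume c: "smooth_map euclidean_manifold M c" "c 0 = p" "v = velocity M c"
  have "f (c t) = g (c t)" for t
    using smooth_map_in_space[OF c(1), of t] assms(3) by simp
  moreover have "f \<in> smooth_functions M \<longleftrightarrow> g \<in> smooth_functions M"
    using smooth_functions_cong[OF assms(1)] assms(3) by metis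
  ultimately show ?thesis using c(3) by (simp add: velocity_def o_def)
qed

lemma differential_cong:
  assumes "charted M" "v \<in> tangent_space M p" "\<And>x. x \<in> man_space M \<Longrightarrow> F x = G x"
  shows "differential N F v = differential N G v"
proof
  fix f
  have "v (f \<circ> F) = v (f \<circ> G)" by (rule tangent_cong[OF assms(1,2)]) (simp add: assms(3))
  then show "differential N F v f = differential N G v f" by (simp add: differential_def)
qed

lemma tangent_nonsmooth: "v \<in> tangent_space M p \<Longrightarrow> f \<notin> smooth_functions M \<Longrightarrow> v f = 0"
  by (auto simp: tangent_space_def velocity_def)

lemma differential_ident:
  assumes "v \<in> tangent_space M p"
  shows "differential M (\<lambda>x. x) v = v"
  using tangent_nonsmooth[OF assms] by (auto simp: differential_def o_def)

lemma differential_linear: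
  "differential N F (\<lambda>f. a * u f + b * v f) = (\<lambda>f. a * differential N F u f + b * differential N F v f)"
  by (auto simp: differential_def)

section \<open>The adjoint representation of a Lie group\<close>

lemma smooth_on_partial:
  fixes K :: "real \<times> real \<Rightarrow> real"
  assumes "smooth_on UNIV K"
  shows "smooth_on UNIV (\<lambda>t. deriv (\<lambda>s. K (t, s)) 0)"
proof -
  have "smooth_on UNIV (\<lambda>t. frechet_derivative K (at (t, 0)) (0, 1))"
    by (rule smooth_on_compose[OF open_UNIV open_UNIV _ smooth_on_derivative[OF assms]])
      (intro smooth_on_linear bounded_linear_intros, simp)
  moreover have "deriv (\<lambda>s. K (t, s)) 0 = frechet_derivative K (at (t, 0)) (0, 1)" for t
    by (intro DERIV_imp_deriv has_partial_deriv_2 smooth_on_differentiable[OF assms] UNIV_I)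
  ultimately show ?thesis by simp
qed

lemma smooth_on_swap:
  assumes "smooth_on UNIV (K :: real \<times> real \<Rightarrow> real)"
  shows "smooth_on UNIV (\<lambda>p. K (snd p, fst p))"
  by (rule smooth_on_compose[OF open_UNIV open_UNIV _ assms])
    (intro smooth_on_linear bounded_linear_intros, simp)

locale lie = group G for G :: "('g, 'e::euclidean_space) lie_group_struct" (structure) +
  assumes lie_group: "lie_group G"
begin

abbreviation "M \<equiv> lg_man G"

abbreviation curve :: "(real \<Rightarrow> 'g) \<Rightarrow> bool" where
  "curve \<equiv> smooth_map euclidean_manifold M"

abbreviation conjugation :: "'g \<Rightarrow> 'g \<Rightarrow> 'g" where
  "conjugation a x \<equiv> a \<otimes> x \<otimes> inv a"

lemma smooth_manifold_M: "smooth_manifold M"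
  and man_space_M [simp]: "man_space M = carrier G"
  using lie_group by (auto simp: lie_group_def)

lemma charted_M [simp]: "charted M"
  using charted_smooth_manifold smooth_manifold_M .

lemma smooth_mult:
  assumes "charted N" "smooth_map N M F" "smooth_map N M F'"
  shows "smooth_map N M (\<lambda>x. F x \<otimes> F' x)"
proof -
  have "smooth_map (prod_manifold M M) M (\<lambda>(x, y). x \<otimes> y)"
    using lie_group by (simp add: lie_group_def)
  from smooth_map_compose[OF assms(1) charted_prod charted_M smooth_map_Pair[OF assms(1) _ _ assms(2,3)] this]
  show ?thesis by simp
qed

lemma smooth_inv:
  assumes "charted N" "smooth_map N M F"
  shows "smooth_map N M (\<lambda>x. inv (F x))"
proof -
  have "smooth_map M M (\<lambda>x. inv x)"
    using lie_group by (simp add: lie_group_def)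
  from smooth_map_compose[OF assms(1) _ _ assms(2) this] show ?thesis by simp
qed

lemma smooth_const: "a \<in> carrier G \<Longrightarrow> smooth_map N M (\<lambda>x. a)"
  by (rule smooth_map_const) simp

lemma smooth_left_mult: "a \<in> carrier G \<Longrightarrow> smooth_map M M (\<lambda>x. a \<otimes> x)"
  by (intro smooth_mult smooth_const smooth_map_ident[OF smooth_manifold_M] charted_M)

lemma smooth_conjugation: "a \<in> carrier G \<Longrightarrow> smooth_map M M (conjugation a)"
  by (intro smooth_mult smooth_const smooth_map_ident[OF smooth_manifold_M] charted_M inv_closed)

lemma curve_closed: "curve c \<Longrightarrow> c t \<in> carrier G"
  using smooth_map_in_space[of euclidean_manifold M c t] by simp

lemma smooth_on_two_curves:
  assumes "curve c" "curve d"
  shows "smooth_map euclidean_manifold M (\<lambda>p::real \<times> real. c (fst p))"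
    and "smooth_map euclidean_manifold M (\<lambda>p::real \<times> real. d (snd p))"
proof -
  have "smooth_map euclidean_manifold euclidean_manifold (fst :: real \<times> real \<Rightarrow> real)"
       "smooth_map euclidean_manifold euclidean_manifold (snd :: real \<times> real \<Rightarrow> real)"
    by (simp_all add: smooth_map_euclidean_iff smooth_on_linear bounded_linear_fst bounded_linear_snd)
  from this[THEN smooth_map_compose[OF charted_euclidean charted_euclidean charted_M]] assms
  show "smooth_map euclidean_manifold M (\<lambda>p::real \<times> real. c (fst p))"
    and "smooth_map euclidean_manifold M (\<lambda>p::real \<times> real. d (snd p))" by blast+
qed

lemma smooth_on_two_param:
  fixes F :: "real \<times> real \<Rightarrow> 'g"
  assumes "smooth_map euclidean_manifold M F" "f \<in> smooth_functions M"
  shows "smooth_on UNIV (\<lambda>p. f (F p))"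
  using smooth_functions_compose[OF charted_euclidean charted_M assms]
  by (simp add: smooth_functions_def smooth_map_euclidean_iff)

lemma deriv_mult_curves:
  assumes "curve c" "curve d" "f \<in> smooth_functions M"
  shows "deriv (\<lambda>t. f (c t \<otimes> d t)) 0 = deriv (\<lambda>t. f (c t \<otimes> d 0)) 0 + deriv (\<lambda>t. f (c 0 \<otimes> d t)) 0"
proof -
  have "smooth_on UNIV (\<lambda>p. f (c (fst p) \<otimes> d (snd p)))"
    using smooth_on_two_curves[OF assms(1,2)] by (intro smooth_on_two_param smooth_mult assms) auto
  from deriv_diagonal[OF smooth_on_differentiable[OF this UNIV_I], of 0] show ?thesis by simp
qed

text \<open>The product rule is applied to the constant curve
  \<open>c t \<otimes> inv (c t)\<close>, after left multiplication by \<open>x\<close> has been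
  absorbed into the test function.\<close>

lemma deriv_inv_curve:
  assumes "curve c" "c 0 = \<one>" "x \<in> carrier G" "f \<in> smooth_functions M"
  shows "deriv (\<lambda>t. f (x \<otimes> inv (c t))) 0 = - deriv (\<lambda>t. f (x \<otimes> c t)) 0"
proof -
  have f: "(\<lambda>y. f (x \<otimes> y)) \<in> smooth_functions M"
    using smooth_functions_compose[OF _ _ smooth_left_mult assms(4)] assms(3) by simp
  have "deriv (\<lambda>t. f (x \<otimes> (c t \<otimes> inv (c t)))) 0 =
     deriv (\<lambda>t. f (x \<otimes> (c t \<otimes> inv (c 0)))) 0 + deriv (\<lambda>t. f (x \<otimes> (c 0 \<otimes> inv (c t)))) 0"
    by (rule deriv_mult_curves[OF assms(1) smooth_inv[OF _ assms(1)] f]) simp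
  then show ?thesis using assms(2) curve_closed[OF assms(1)] by simp
qed

text \<open>The group product replaces an argument in charts: by the product rule, the product of
  two rescaled curves through the identity has the linear combination as its velocity.\<close>

lemma tangent_one_linear:
  assumes "u \<in> tangent_space M \<one>" "v \<in> tangent_space M \<one>"
  shows "(\<lambda>f. a * u f + b * v f) \<in> tangent_space M \<one>"
proof -
  have scale: "curve (\<lambda>t. c (r * t))" if "curve c" for c r
    by (rule smooth_map_compose[OF _ _ _ _ that])
      (auto simp: smooth_map_euclidean_iff intro!: smooth_on_linear bounded_linear_mult_right)
  have deriv: "deriv (\<lambda>t. f (c (r * t))) 0 = r * deriv (\<lambda>t. f (c t)) 0"
    if "curve c" "f \<in> smooth_functions M" for c r f
  proof -
    have "((\<lambda>t. f (c t)) has_real_derivative deriv (\<lambda>t. f (c t)) 0) (at (r * 0))"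
      using smooth_on_deriv[OF smooth_function_curve[OF charted_M that]] by simp
    from DERIV_chain2[where f = "\<lambda>t. f (c t)" and g = "\<lambda>t. r * t" and x = 0 and Db = r and s = UNIV, OF this]
    have "((\<lambda>t. f (c (r * t))) has_real_derivative deriv (\<lambda>t. f (c t)) 0 * r) (at 0)"
      by (auto intro: derivative_eq_intros)
    then show ?thesis by (simp add: DERIV_imp_deriv)
  qed
  obtain c where c: "curve c" "c 0 = \<one>" "u = velocity M c" using assms(1) by (rule tangent_spaceE)
  obtain d where d: "curve d" "d 0 = \<one>" "v = velocity M d" using assms(2) by (rule tangent_spaceE)
  define e where "e = (\<lambda>t. c (a * t) \<otimes> d (b * t))"
  have e: "curve e" unfolding e_def by (intro smooth_mult scale c d) simp
  have "velocity M e = (\<lambda>f. a * u f + b * v f)"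
  proof
    fix f
    show "velocity M e f = a * u f + b * v f"
    proof (cases "f \<in> smooth_functions M")
      case True
      then have "velocity M e f = deriv (\<lambda>t. f (c (a * t))) 0 + deriv (\<lambda>t. f (d (b * t))) 0"
        using deriv_mult_curves[OF scale[OF c(1)] scale[OF d(1)] True, of a b] c d
          curve_closed[OF c(1)] curve_closed[OF d(1)]
        by (simp add: velocity_apply e_def)
      then show ?thesis
        using True deriv[OF c(1) True, of a] deriv[OF d(1) True, of b] by (simp add: c d velocity_apply)
    qed (simp add: velocity_def c d)
  qed
  moreover have "e 0 = \<one>" by (simp add: e_def c d)
  ultimately show ?thesis using velocity_tangent[OF e] by simp
qed

lemma left_invariant_at_one: "X \<in> left_invariant_fields G \<Longrightarrow> X \<one> \<in> tangent_space M \<one>"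
  by (auto simp: left_invariant_fields_def vector_fields_def)

lemma left_invariant_smooth:
  "X \<in> left_invariant_fields G \<Longrightarrow> f \<in> smooth_functions M \<Longrightarrow> (\<lambda>p. X p f) \<in> smooth_functions M"
  by (auto simp: left_invariant_fields_def vector_fields_def)

lemma left_invariant_value:
  assumes "X \<in> left_invariant_fields G" "p \<in> carrier G"
  shows "X p = differential M (\<lambda>x. p \<otimes> x) (X \<one>)"
proof -
  have "differential M (\<lambda>x. p \<otimes> x) (X \<one>) = X (p \<otimes> \<one>)"
    using assms unfolding left_invariant_fields_def by blast
  then show ?thesis using assms by simp
qed

lemma left_invariant_eqI:
  assumes "X \<in> left_invariant_fields G" "Y \<in> left_invariant_fields G" "X \<one> = Y \<one>"
  shows "X = Y"
proof
  fix p
  show "X p = Y p"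
  proof (cases "p \<in> carrier G")
    case True
    show ?thesis
      using left_invariant_value[OF assms(1) True] left_invariant_value[OF assms(2) True] assms(3) by simp
  next
    case False
    \<comment> \<open>Outside the carrier \<open>vector_fields\<close> prescribes the zero
      functional.\<close>
    then have "X p = (\<lambda>f. 0)" "Y p = (\<lambda>f. 0)"
      using assms(1,2) by (simp_all add: left_invariant_fields_def vector_fields_def)
    then show ?thesis by simp
  qed
qed

lemma left_invariant_deriv:
  assumes "X \<in> left_invariant_fields G" "curve c" "velocity M c = X \<one>"
    and "p \<in> carrier G" "f \<in> smooth_functions M"
  shows "X p f = deriv (\<lambda>t. f (p \<otimes> c t)) 0"
  using left_invariant_value[OF assms(1,4)] assms(3)[symmetric]
    smooth_functions_compose[OF _ _ smooth_left_mult assms(5)] assms(4,5)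
  by (simp add: differential_apply velocity_apply)

text \<open>Both orders of differentiation are computed for \<open>(t, s) \<mapsto> f (c t \<otimes> d s \<otimes> inv (c t))\<close> at the
  origin, where \<open>d\<close> is a curve with velocity \<open>X \<one>\<close>.\<close>

lemma adjoint_deriv:
  assumes X: "X \<in> left_invariant_fields G" and Y: "Y \<in> left_invariant_fields G"
    and c: "curve c" "c 0 = \<one>" "velocity M c = Y \<one>" and f: "f \<in> smooth_functions M"
  shows "((\<lambda>t. differential M (conjugation (c t)) (X \<one>) f) has_real_derivative
    vf_bracket M Y X \<one> f) (at 0)"
proof -
  obtain d where d: "curve d" "d 0 = \<one>" "X \<one> = velocity M d"
    using left_invariant_at_one[OF X] by (rule tangent_spaceE)
  define H where "H = (\<lambda>p. f (c (fst p) \<otimes> d (snd p) \<otimes> inv (c (fst p))))"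
  define K where "K = (\<lambda>p. f (c (fst p) \<otimes> d (snd p)))"
  note [simp] = curve_closed[OF c(1)] curve_closed[OF d(1)]
  have H: "smooth_on UNIV H" and K: "smooth_on UNIV K"
    unfolding H_def K_def using smooth_on_two_curves[OF c(1) d(1)]
    by (auto intro!: smooth_on_two_param smooth_mult smooth_inv f)
  have val: "differential M (conjugation (c t)) (X \<one>) f = deriv (\<lambda>s. H (t, s)) 0" for t
    using f smooth_functions_compose[OF _ _ smooth_conjugation f, of "c t"]
    by (simp add: differential_apply d velocity_apply H_def)
  have sY: "smooth_on UNIV (\<lambda>s. Y (d s) f)"
    using smooth_function_curve[OF charted_M d(1) left_invariant_smooth[OF Y f]] .
  have sK: "smooth_on UNIV (\<lambda>s. deriv (\<lambda>t. K (t, s)) 0)"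
    using smooth_on_partial[OF smooth_on_swap[OF K]] by simp
  \<comment> \<open>The product rule at \<open>t = 0\<close> splits conjugation into its left
    factor, which gives \<open>K\<close>, and its inverse factor, which contributes the derivative
    along \<open>Y\<close> with a minus sign.\<close>
  have "deriv (\<lambda>t. H (t, s)) 0 = deriv (\<lambda>t. K (t, s)) 0 - Y (d s) f" for s
  proof -
    have "curve (\<lambda>t. c t \<otimes> d s)" "curve (\<lambda>t. inv (c t))"
      by (intro smooth_mult smooth_inv c smooth_const; simp)+
    from deriv_mult_curves[OF this f]
    have "deriv (\<lambda>t. H (t, s)) 0 = deriv (\<lambda>t. K (t, s)) 0 + deriv (\<lambda>t. f (d s \<otimes> inv (c t))) 0"
      by (simp add: H_def K_def c(2))
    then show ?thesis
      using deriv_inv_curve[OF c(1,2) _ f, of "d s"] left_invariant_deriv[OF Y c(1,3) _ f, of "d s"]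
      by simp
  qed
  then have "deriv (\<lambda>t. deriv (\<lambda>s. H (t, s)) 0) 0 = deriv (\<lambda>s. deriv (\<lambda>t. K (t, s)) 0 - Y (d s) f) 0"
    using mixed_partials_commute[OF H] by simp
  also have "\<dots> = deriv (\<lambda>s. deriv (\<lambda>t. K (t, s)) 0) 0 - deriv (\<lambda>s. Y (d s) f) 0"
    by (intro DERIV_imp_deriv DERIV_diff smooth_on_deriv sK sY)
  also have "deriv (\<lambda>s. Y (d s) f) 0 = X \<one> (\<lambda>q. Y q f)"
    using left_invariant_smooth[OF Y f] by (simp add: d velocity_apply)
  \<comment> \<open>The order is exchanged once more, now for \<open>K\<close>: left invariance
    identifies its derivative in \<open>s\<close> at 0 with \<open>X\<close> at the point
    \<open>c t\<close>.\<close>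
  also have "deriv (\<lambda>s. deriv (\<lambda>t. K (t, s)) 0) 0 = deriv (\<lambda>t. X (c t) f) 0"
    using mixed_partials_commute[OF K] left_invariant_deriv[OF X d(1) d(3)[symmetric] _ f]
    by (simp add: K_def)
  also have "\<dots> = Y \<one> (\<lambda>q. X q f)"
    using left_invariant_smooth[OF X f] by (simp add: c(3)[symmetric] velocity_apply)
  finally have "deriv (\<lambda>t. deriv (\<lambda>s. H (t, s)) 0) 0 = vf_bracket M Y X \<one> f"
    using f by (simp add: vf_bracket_def)
  then show ?thesis
    using smooth_on_deriv[OF smooth_on_partial[OF H], of 0] by (simp add: val)
qed

end

section \<open>Computations in the split Lie algebra of type \<open>G\<^sub>2\<close>\<close>

text \<open>All fifteen coordinates of V + gl(V) + V*, the matrix row by row; trace zero is a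
  separate condition. In this form brackets are explicit polynomials, and identities between them
  are left to the simplifier.\<close>

definition coords ::
  "real \<Rightarrow> real \<Rightarrow> real \<Rightarrow> real \<Rightarrow> real \<Rightarrow> real \<Rightarrow> real \<Rightarrow> real \<Rightarrow> real \<Rightarrow> real \<Rightarrow> real \<Rightarrow> real \<Rightarrow> real \<Rightarrow> real \<Rightarrow> real \<Rightarrow> gvec" where
  "coords x1 x2 x3 a11 a12 a13 a21 a22 a23 a31 a32 a33 p1 p2 p3 =
    (vector [x1, x2, x3],
     vector [vector [a11, a12, a13], vector [a21, a22, a23], vector [a31, a32, a33]],
     vector [p1, p2, p3])"

lemma coords_exhaust:
  obtains x1 x2 x3 a11 a12 a13 a21 a22 a23 a31 a32 a33 p1 p2 p3
  where "X = coords x1 x2 x3 a11 a12 a13 a21 a22 a23 a31 a32 a33 p1 p2 p3"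
proof -
  obtain x A p where X: "X = (x, A, p)" by (cases X) auto
  have "X = coords (x $ 1) (x $ 2) (x $ 3) (A $ 1 $ 1) (A $ 1 $ 2) (A $ 1 $ 3) (A $ 2 $ 1) (A $ 2 $ 2)
     (A $ 2 $ 3) (A $ 3 $ 1) (A $ 3 $ 2) (A $ 3 $ 3) (p $ 1) (p $ 2) (p $ 3)"
    by (simp add: X coords_def vec_eq_iff forall_3)
  then show thesis by (rule that)
qed

lemma coords_eq_iff [simp]:
  "coords x1 x2 x3 a11 a12 a13 a21 a22 a23 a31 a32 a33 p1 p2 p3 =
   coords y1 y2 y3 b11 b12 b13 b21 b22 b23 b31 b32 b33 q1 q2 q3 \<longleftrightarrow>
   x1 = y1 \<and> x2 = y2 \<and> x3 = y3 \<and> a11 = b11 \<and> a12 = b12 \<and> a13 = b13 \<and> a21 = b21 \<and> a22 = b22 \<and> a23 = b23 \<and>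
   a31 = b31 \<and> a32 = b32 \<and> a33 = b33 \<and> p1 = q1 \<and> p2 = q2 \<and> p3 = q3"
  by (auto simp: coords_def vec_eq_iff forall_3)

lemma coords_add [simp]:
  "coords x1 x2 x3 a11 a12 a13 a21 a22 a23 a31 a32 a33 p1 p2 p3 +
   coords y1 y2 y3 b11 b12 b13 b21 b22 b23 b31 b32 b33 q1 q2 q3 =
   coords (x1 + y1) (x2 + y2) (x3 + y3) (a11 + b11) (a12 + b12) (a13 + b13) (a21 + b21) (a22 + b22)
     (a23 + b23) (a31 + b31) (a32 + b32) (a33 + b33) (p1 + q1) (p2 + q2) (p3 + q3)"
  by (simp add: coords_def vec_eq_iff forall_3)

lemma coords_scaleR [simp]:
  "r *\<^sub>R coords x1 x2 x3 a11 a12 a13 a21 a22 a23 a31 a32 a33 p1 p2 p3 =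
   coords (r * x1) (r * x2) (r * x3) (r * a11) (r * a12) (r * a13) (r * a21) (r * a22)
     (r * a23) (r * a31) (r * a32) (r * a33) (r * p1) (r * p2) (r * p3)"
  by (simp add: coords_def vec_eq_iff forall_3)

lemma coords_inner [simp]:
  "coords x1 x2 x3 a11 a12 a13 a21 a22 a23 a31 a32 a33 p1 p2 p3 \<bullet>
   coords y1 y2 y3 b11 b12 b13 b21 b22 b23 b31 b32 b33 q1 q2 q3 =
   x1 * y1 + x2 * y2 + x3 * y3 + a11 * b11 + a12 * b12 + a13 * b13 + a21 * b21 + a22 * b22 + a23 * b23 +
   a31 * b31 + a32 * b32 + a33 * b33 + p1 * q1 + p2 * q2 + p3 * q3"
  by (simp add: coords_def inner_vec_def sum_3)

lemma zero_coords: "0 = coords 0 0 0 0 0 0 0 0 0 0 0 0 0 0 0"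
  by (simp add: coords_def vec_eq_iff forall_3 zero_prod_def)

lemma ev_coords:
  "ev 1 = coords 1 0 0 0 0 0 0 0 0 0 0 0 0 0 0"
  "ev 2 = coords 0 1 0 0 0 0 0 0 0 0 0 0 0 0 0"
  "ev 3 = coords 0 0 1 0 0 0 0 0 0 0 0 0 0 0 0"
  by (simp_all add: ev_def coords_def vec_eq_iff forall_3 axis_def)

lemma ecov_coords:
  "ecov 1 = coords 0 0 0 0 0 0 0 0 0 0 0 0 1 0 0"
  "ecov 2 = coords 0 0 0 0 0 0 0 0 0 0 0 0 0 1 0"
  "ecov 3 = coords 0 0 0 0 0 0 0 0 0 0 0 0 0 0 1"
  by (simp_all add: ecov_def coords_def vec_eq_iff forall_3 axis_def)

lemma emat_coords:
  "emat 1 1 = coords 0 0 0 1 0 0 0 0 0 0 0 0 0 0 0"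
  "emat 1 2 = coords 0 0 0 0 1 0 0 0 0 0 0 0 0 0 0"
  "emat 1 3 = coords 0 0 0 0 0 1 0 0 0 0 0 0 0 0 0"
  "emat 2 1 = coords 0 0 0 0 0 0 1 0 0 0 0 0 0 0 0"
  "emat 2 2 = coords 0 0 0 0 0 0 0 1 0 0 0 0 0 0 0"
  "emat 2 3 = coords 0 0 0 0 0 0 0 0 1 0 0 0 0 0 0"
  "emat 3 1 = coords 0 0 0 0 0 0 0 0 0 1 0 0 0 0 0"
  "emat 3 2 = coords 0 0 0 0 0 0 0 0 0 0 1 0 0 0 0"
  "emat 3 3 = coords 0 0 0 0 0 0 0 0 0 0 0 1 0 0 0"
  by (simp_all add: emat_def tensor_def coords_def vec_eq_iff forall_3 axis_def)

lemmas basis_coords = ev_coords ecov_coords emat_coords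

lemma g2_bracket_coords:
  "g2_bracket (coords x1 x2 x3 a11 a12 a13 a21 a22 a23 a31 a32 a33 p1 p2 p3)
      (coords y1 y2 y3 b11 b12 b13 b21 b22 b23 b31 b32 b33 q1 q2 q3) =
    coords
      (a11 * y1 + a12 * y2 + a13 * y3 - b11 * x1 - b12 * x2 - b13 * x3 + 2 * p2 * q3 - 2 * p3 * q2)
      (a21 * y1 + a22 * y2 + a23 * y3 - b21 * x1 - b22 * x2 - b23 * x3 + 2 * p3 * q1 - 2 * p1 * q3)
      (a31 * y1 + a32 * y2 + a33 * y3 - b31 * x1 - b32 * x2 - b33 * x3 + 2 * p1 * q2 - 2 * p2 * q1)
      (a12 * b21 + a13 * b31 - a21 * b12 - a31 * b13 + 2 * q1 * x1 - q2 * x2 - q3 * x3 - 2 * p1 * y1 + p2 * y2 + p3 * y3)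
      (a11 * b12 + a12 * b22 + a13 * b32 - a12 * b11 - a22 * b12 - a32 * b13 + 3 * q2 * x1 - 3 * p2 * y1)
      (a11 * b13 + a12 * b23 + a13 * b33 - a13 * b11 - a23 * b12 - a33 * b13 + 3 * q3 * x1 - 3 * p3 * y1)
      (a21 * b11 + a22 * b21 + a23 * b31 - a11 * b21 - a21 * b22 - a31 * b23 + 3 * q1 * x2 - 3 * p1 * y2)
      (a21 * b12 + a23 * b32 - a12 * b21 - a32 * b23 + 2 * q2 * x2 - q1 * x1 - q3 * x3 - 2 * p2 * y2 + p1 * y1 + p3 * y3)
      (a21 * b13 + a22 * b23 + a23 * b33 - a13 * b21 - a23 * b22 - a33 * b23 + 3 * q3 * x2 - 3 * p3 * y2)
      (a31 * b11 + a32 * b21 + a33 * b31 - a11 * b31 - a21 * b32 - a31 * b33 + 3 * q1 * x3 - 3 * p1 * y3)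
      (a31 * b12 + a32 * b22 + a33 * b32 - a12 * b31 - a22 * b32 - a32 * b33 + 3 * q2 * x3 - 3 * p2 * y3)
      (a31 * b13 + a32 * b23 - a13 * b31 - a23 * b32 + 2 * q3 * x3 - q1 * x1 - q2 * x2 - 2 * p3 * y3 + p1 * y1 + p2 * y2)
      (b11 * p1 + b21 * p2 + b31 * p3 - a11 * q1 - a21 * q2 - a31 * q3 - 2 * x2 * y3 + 2 * x3 * y2)
      (b12 * p1 + b22 * p2 + b32 * p3 - a12 * q1 - a22 * q2 - a32 * q3 - 2 * x3 * y1 + 2 * x1 * y3)
      (b13 * p1 + b23 * p2 + b33 * p3 - a13 * q1 - a23 * q2 - a33 * q3 - 2 * x1 * y2 + 2 * x2 * y1)"
  by (simp add: coords_def vec_eq_iff forall_3 matrix_matrix_mult_def matrix_vector_mult_def sum_3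
      transpose_def cross3_simps pairing_def tensor_def mat_def inner_vec_def algebra_simps)

lemma linear_g2_bracket: "linear (g2_bracket X)"
proof (rule linearI)
  fix Y Z :: gvec and r :: real
  show "g2_bracket X (Y + Z) = g2_bracket X Y + g2_bracket X Z"
    by (rule coords_exhaust[of X], rule coords_exhaust[of Y], rule coords_exhaust[of Z])
      (simp add: g2_bracket_coords algebra_simps)
  show "g2_bracket X (r *\<^sub>R Y) = r *\<^sub>R g2_bracket X Y"
    by (rule coords_exhaust[of X], rule coords_exhaust[of Y]) (simp add: g2_bracket_coords algebra_simps)
qed

lemma coords_in_g2:
  "coords x1 x2 x3 a11 a12 a13 a21 a22 a23 a31 a32 a33 p1 p2 p3 \<in> g2 \<longleftrightarrow> a11 + a22 + a33 = 0"
  by (simp add: g2_def coords_def trace_def sum_3)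

lemma subspace_g2: "subspace g2"
proof (rule subspaceI)
  show "0 \<in> g2" by (simp add: zero_coords coords_in_g2)
  show "X + Y \<in> g2" if "X \<in> g2" "Y \<in> g2" for X Y
    using that by (rule_tac coords_exhaust[of X], rule_tac coords_exhaust[of Y]) (simp add: coords_in_g2)
  show "r *\<^sub>R X \<in> g2" if "X \<in> g2" for r X
    using that by (rule_tac coords_exhaust[of X])
      (simp add: coords_in_g2, metis distrib_left mult_zero_right)
qed

lemma g2_bracket_in_g2: "g2_bracket X Y \<in> g2"
  by (rule coords_exhaust[of X], rule coords_exhaust[of Y])
    (simp add: g2_bracket_coords coords_in_g2 algebra_simps)

section \<open>The Cartan subalgebra, \<open>l_alg\<close> and its one-dimensional ideals\<close>

lemma cartan_coords: "cartan = {coords 0 0 0 a 0 0 0 b 0 0 0 (- a - b) 0 0 0 | a b. True}"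
proof (intro equalityI subsetI)
  fix X assume "X \<in> cartan"
  then obtain c :: "3 \<Rightarrow> real" where c: "X = c 1 *\<^sub>R emat 1 1 + c 2 *\<^sub>R emat 2 2 + c 3 *\<^sub>R emat 3 3"
    "c 1 + c 2 + c 3 = 0"
    unfolding cartan_def by (auto simp: sum_3)
  moreover have "c 3 = - c 1 - c 2" using c(2) by simp
  ultimately show "X \<in> {coords 0 0 0 a 0 0 0 b 0 0 0 (- a - b) 0 0 0 | a b. True}"
    by (auto simp: emat_coords)
next
  fix X assume "X \<in> {coords 0 0 0 a 0 0 0 b 0 0 0 (- a - b) 0 0 0 | a b. True}"
  then obtain a b where X: "X = coords 0 0 0 a 0 0 0 b 0 0 0 (- a - b) 0 0 0" by blast
  define c :: "3 \<Rightarrow> real" where "c = (\<lambda>i. if i = 1 then a else if i = 2 then b else - a - b)"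
  have "X = (\<Sum>i\<in>UNIV. c i *\<^sub>R emat i i)" "(\<Sum>i\<in>UNIV. c i) = 0"
    by (simp_all add: sum_3 c_def X emat_coords)
  then show "X \<in> cartan" unfolding cartan_def by blast
qed

lemma l_alg_coords:
  "l_alg = {coords x1 0 0 a11 a12 a13 0 a22 a23 0 0 (- a11 - a22) 0 p2 p3 | x1 a11 a12 a13 a22 a23 p2 p3. True}"
proof (intro equalityI subsetI)
  let ?N = "{coords x1 0 0 0 a12 a13 0 0 a23 0 0 0 0 p2 p3 | x1 a12 a13 a23 p2 p3. True}"
  fix X assume "X \<in> l_alg"
  then obtain H Y where X: "X = H + Y" "H \<in> cartan" "Y \<in> span {ev 1, ecov 2, ecov 3, emat 1 2, emat 1 3, emat 2 3}"
    unfolding l_alg_def by blast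
  have "subspace ?N"
    by (rule subspaceI) (auto simp: zero_coords)
  then have "Y \<in> ?N"
    using X(3) span_minimal[of "{ev 1, ecov 2, ecov 3, emat 1 2, emat 1 3, emat 2 3}" ?N]
    by (auto simp: basis_coords)
  then show "X \<in> {coords x1 0 0 a11 a12 a13 0 a22 a23 0 0 (- a11 - a22) 0 p2 p3 | x1 a11 a12 a13 a22 a23 p2 p3. True}"
    using X by (auto simp: cartan_coords)
next
  fix X assume "X \<in> {coords x1 0 0 a11 a12 a13 0 a22 a23 0 0 (- a11 - a22) 0 p2 p3 | x1 a11 a12 a13 a22 a23 p2 p3. True}"
  then obtain x1 a11 a12 a13 a22 a23 p2 p3
    where X: "X = coords x1 0 0 a11 a12 a13 0 a22 a23 0 0 (- a11 - a22) 0 p2 p3" by blast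
  have "X = coords 0 0 0 a11 0 0 0 a22 0 0 0 (- a11 - a22) 0 0 0 +
    (x1 *\<^sub>R ev 1 + p2 *\<^sub>R ecov 2 + p3 *\<^sub>R ecov 3 + a12 *\<^sub>R emat 1 2 + a13 *\<^sub>R emat 1 3 + a23 *\<^sub>R emat 2 3)"
    by (simp add: X basis_coords)
  moreover have "coords 0 0 0 a11 0 0 0 a22 0 0 0 (- a11 - a22) 0 0 0 \<in> cartan"
    by (auto simp: cartan_coords)
  moreover have "x1 *\<^sub>R ev 1 + p2 *\<^sub>R ecov 2 + p3 *\<^sub>R ecov 3 + a12 *\<^sub>R emat 1 2 + a13 *\<^sub>R emat 1 3 + a23 *\<^sub>R emat 2 3
      \<in> span {ev 1, ecov 2, ecov 3, emat 1 2, emat 1 3, emat 2 3}"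
    by (intro span_add span_scale span_base) auto
  ultimately show "X \<in> l_alg" unfolding l_alg_def by blast
qed

lemma coords_in_l_alg:
  "coords x1 x2 x3 a11 a12 a13 a21 a22 a23 a31 a32 a33 p1 p2 p3 \<in> l_alg \<longleftrightarrow>
    x2 = 0 \<and> x3 = 0 \<and> a21 = 0 \<and> a31 = 0 \<and> a32 = 0 \<and> a33 = - a11 - a22 \<and> p1 = 0"
  by (auto simp: l_alg_coords)

lemma subspace_l_alg: "subspace l_alg"
proof (rule subspaceI)
  show "0 \<in> l_alg" by (simp add: zero_coords coords_in_l_alg)
  show "X + Y \<in> l_alg" if "X \<in> l_alg" "Y \<in> l_alg" for X Y
    using that by (rule_tac coords_exhaust[of X], rule_tac coords_exhaust[of Y]) (simp add: coords_in_l_alg)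
  show "r *\<^sub>R X \<in> l_alg" if "X \<in> l_alg" for r X
    using that by (rule_tac coords_exhaust[of X]) (simp add: coords_in_l_alg right_diff_distrib)
qed

lemma l_alg_subset_g2: "l_alg \<subseteq> g2"
  by (auto simp: l_alg_coords coords_in_g2)

lemma l_alg_bracket: "X \<in> l_alg \<Longrightarrow> Y \<in> l_alg \<Longrightarrow> g2_bracket X Y \<in> l_alg"
  by (rule coords_exhaust[of X], rule coords_exhaust[of Y])
    (simp add: coords_in_l_alg g2_bracket_coords algebra_simps)

lemma emat_13_in_l_alg: "emat 1 3 \<in> l_alg"
  by (simp add: emat_coords coords_in_l_alg)

lemma emat_13_ideal:
  assumes "Y \<in> l_alg"
  shows "\<exists>\<mu>. g2_bracket Y (emat 1 3) = \<mu> *\<^sub>R emat 1 3"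
proof -
  obtain x1 a11 a12 a13 a22 a23 p2 p3
    where "Y = coords x1 0 0 a11 a12 a13 0 a22 a23 0 0 (- a11 - a22) 0 p2 p3"
    using assms by (auto simp: l_alg_coords)
  then show ?thesis
    \<comment> \<open>The factor is the value \<open>a11 - a33\<close> of the root of
      \<open>emat 1 3\<close>, rewritten with trace zero.\<close>
    by (intro exI[of _ "2 * a11 + a22"]) (simp add: emat_coords g2_bracket_coords)
qed

text \<open>The roots of \<open>l_alg\<close> take distinct nonzero values on the diagonal matrix with entries
  \<open>3, 1, -4\<close>, so an eigenvector of all brackets lies in a root space or in the Cartan subalgebra.\<close>

lemma l_alg_ideal_unique:
  assumes X: "X \<in> l_alg" and ideal: "\<And>Y. Y \<in> l_alg \<Longrightarrow> \<exists>\<mu>. g2_bracket Y X = \<mu> *\<^sub>R X"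
  shows "\<exists>c. X = c *\<^sub>R emat 1 3"
proof -
  obtain x1 a11 a12 a13 a22 a23 p2 p3
    where X: "X = coords x1 0 0 a11 a12 a13 0 a22 a23 0 0 (- a11 - a22) 0 p2 p3"
    using X by (auto simp: l_alg_coords)
  obtain m0 where m0: "g2_bracket (coords 0 0 0 3 0 0 0 1 0 0 0 (- 4) 0 0 0) X = m0 *\<^sub>R X"
    using ideal[of "coords 0 0 0 3 0 0 0 1 0 0 0 (- 4) 0 0 0"] by (auto simp: coords_in_l_alg)
  obtain m1 where m1: "g2_bracket (emat 1 2) X = m1 *\<^sub>R X"
    using ideal[of "emat 1 2"] by (auto simp: basis_coords coords_in_l_alg)
  obtain m2 where m2: "g2_bracket (emat 2 3) X = m2 *\<^sub>R X"
    using ideal[of "emat 2 3"] by (auto simp: basis_coords coords_in_l_alg)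
  obtain m3 where m3: "g2_bracket (ecov 3) X = m3 *\<^sub>R X"
    using ideal[of "ecov 3"] by (auto simp: basis_coords coords_in_l_alg)
  obtain m4 where m4: "g2_bracket (ev 1) X = m4 *\<^sub>R X"
    using ideal[of "ev 1"] by (auto simp: basis_coords coords_in_l_alg)
  have weights: "x1 = 0 \<or> m0 = 3" "a11 = 0 \<or> m0 = 0" "a22 = 0 \<or> m0 = 0" "a12 = 0 \<or> m0 = 2"
    "a23 = 0 \<or> m0 = 5" "p3 = 0 \<or> m0 = 4" "a13 = 0 \<or> m0 = 7"
    using m0 by (auto simp: X g2_bracket_coords)
  have "p2 * (m0 + 1) = 0"
    using m0 by (simp add: X g2_bracket_coords algebra_simps)
  then have weight_p2: "p2 = 0 \<or> m0 = - 1" by auto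
  \<comment> \<open>Every equation except the first and the third ties a component to one in another
    root space. If the former were nonzero, it would fix \<open>m0\<close> at a value that makes the
    latter 0, and the equation would fail.\<close>
  have eqs: "a22 - a11 = m1 * a12" "a23 = m1 * a13" "- a11 - 2 * a22 = m2 * a23" "- a12 = m2 * a13"
    "- p2 = m2 * p3" "- (3 * x1) = m3 * a13" "3 * p3 = m4 * a13"
    using m1 m2 m3 m4 by (simp_all add: X basis_coords g2_bracket_coords)
  have "x1 = 0" using eqs(6) weights(1,7) by auto
  moreover have "a12 = 0" using eqs(4) weights(4,7) by auto
  moreover have "a23 = 0" using eqs(2) weights(5,7) by auto
  moreover have "p3 = 0" using eqs(7) weights(6,7) by auto
  moreover have "p2 = 0" using eqs(5) weights(6) weight_p2 by auto
  \<comment> \<open>What remains is a Cartan element on which the roots of \<open>emat 1 2\<close>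
    and \<open>emat 2 3\<close> vanish; these two roots are linearly independent.\<close>
  moreover have "a22 = 0" "a11 = 0" using eqs(1,3) calculation by simp_all
  ultimately show ?thesis by (intro exI[of _ a13]) (simp add: X emat_coords)
qed

text \<open>\<open>trace_on\<close> uses an unspecified basis of the subspace. Composing with a
  projection \<open>P\<close> onto \<open>W\<close> turns the trace into one over the ambient space,
  computable in the standard basis. Expanding \<open>T (P e)\<close> in the chosen basis and
  exchanging the sums lets the standard coordinates of each \<open>b\<close> recombine to
  \<open>b\<close>.\<close>

lemma trace_on_eq_sum:
  fixes T P :: "'a::euclidean_space \<Rightarrow> 'a"
  assumes W: "subspace W" and T: "linear T" "\<And>x. x \<in> W \<Longrightarrow> T x \<in> W"
    and P: "linear P" "\<And>x. P x \<in> W" "\<And>x. x \<in> W \<Longrightarrow> P x = x"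
  shows "trace_on W T = (\<Sum>e\<in>Basis. T (P e) \<bullet> e)"
proof -
  define B where "B = (SOME B. independent B \<and> span B = W)"
  have "\<exists>B. independent B \<and> span B = W"
    using basis_exists[of W] span_subspace[OF _ _ W] by metis
  then have B: "independent B" "span B = W"
    unfolding B_def by (metis (mono_tags, lifting) someI_ex)+
  have finB: "finite B" using B(1) independent_bound by blast
  interpret T: linear T by fact
  interpret P: linear P by fact
  have TP: "T (P x) \<in> span B" for x using T(2) P(2) B(2) by simp
  have "(\<Sum>e\<in>Basis. T (P e) \<bullet> e) =
      (\<Sum>e\<in>Basis. (\<Sum>b\<in>B. representation B (T (P e)) b *\<^sub>R b) \<bullet> e)"
    using sum_representation_eq[OF B(1) TP finB order_refl] by simp
  also have "\<dots> = (\<Sum>e\<in>Basis. \<Sum>b\<in>B. (b \<bullet> e) * representation B (T (P e)) b)"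
    by (simp add: inner_sum_left mult.commute)
  also have "\<dots> = (\<Sum>b\<in>B. \<Sum>e\<in>Basis. (b \<bullet> e) * representation B (T (P e)) b)"
    by (rule sum.swap)
  also have "\<dots> = (\<Sum>b\<in>B. representation B (T b) b)"
  proof (rule sum.cong[OF refl])
    fix b assume b: "b \<in> B"
    have "T b = T (P (\<Sum>e\<in>Basis. (b \<bullet> e) *\<^sub>R e))"
      using P(3)[of b] b B(2) span_base[of b B] by (simp add: euclidean_representation)
    also have "\<dots> = (\<Sum>e\<in>Basis. (b \<bullet> e) *\<^sub>R T (P e))"
      by (simp only: T.sum P.sum T.scale P.scale)
    finally show "(\<Sum>e\<in>Basis. (b \<bullet> e) * representation B (T (P e)) b) = representation B (T b) b"
      using B(1) TP by (simp add: representation_sum representation_scale span_scale)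
  qed
  finally show ?thesis by (simp add: trace_on_def B_def Let_def)
qed

section \<open>Explicit evaluation of the Killing form\<close>

lemma sum_Basis_vec3:
  fixes f :: "'a::euclidean_space ^ 3 \<Rightarrow> 'b::comm_monoid_add"
  shows "sum f Basis = (\<Sum>u\<in>Basis. f (axis 1 u)) + (\<Sum>u\<in>Basis. f (axis 2 u)) + (\<Sum>u\<in>Basis. f (axis 3 u))"
proof -
  have "sum f Basis = (\<Sum>i\<in>UNIV. sum f (axis i ` Basis))"
    unfolding Basis_vec_def image_UN[symmetric]
    by (subst sum.UNION_disjoint[symmetric]) (auto simp: axis_eq_axis nonzero_Basis intro!: sum.cong)
  also have "\<dots> = (\<Sum>i\<in>UNIV. \<Sum>u\<in>Basis. f (axis i u))"
    by (intro sum.cong refl sum.reindex_cong[of "axis _"]) (auto simp: inj_on_def axis_eq_axis nonzero_Basis)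
  finally show ?thesis by (simp add: sum_3)
qed

lemma sum_Basis_prod:
  fixes f :: "'a::euclidean_space \<times> 'b::euclidean_space \<Rightarrow> 'c::comm_monoid_add"
  shows "sum f Basis = (\<Sum>u\<in>Basis. f (u, 0)) + (\<Sum>v\<in>Basis. f (0, v))"
  unfolding Basis_prod_def
  by (subst sum.union_disjoint) (auto simp: sum.reindex inj_on_def)

lemma sum_Basis_coords:
  fixes f :: "gvec \<Rightarrow> real"
  shows "sum f Basis = f (ev 1) + f (ev 2) + f (ev 3) +
    f (emat 1 1) + f (emat 1 2) + f (emat 1 3) + f (emat 2 1) + f (emat 2 2) + f (emat 2 3) +
    f (emat 3 1) + f (emat 3 2) + f (emat 3 3) + f (ecov 1) + f (ecov 2) + f (ecov 3)"
proof -
  have "axis i (axis j 1) = tensor (axis i 1) (axis j 1)" for i j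
    by (auto simp: tensor_def axis_def vec_eq_iff)
  then show ?thesis
    by (simp add: sum_Basis_prod sum_Basis_vec3 ev_def ecov_def emat_def zero_prod_def add.assoc)
qed

text \<open>Removes a third of the trace times the identity matrix; the inner product is the trace.
  The standard basis vectors \<open>emat i i\<close> lie outside \<open>g2\<close>, hence the
  projection.\<close>

definition g2_proj :: "gvec \<Rightarrow> gvec" where
  "g2_proj X = X - ((X \<bullet> coords 0 0 0 1 0 0 0 1 0 0 0 1 0 0 0) / 3) *\<^sub>R coords 0 0 0 1 0 0 0 1 0 0 0 1 0 0 0"

lemma coords_diff [simp]:
  "coords x1 x2 x3 a11 a12 a13 a21 a22 a23 a31 a32 a33 p1 p2 p3 -
   coords y1 y2 y3 b11 b12 b13 b21 b22 b23 b31 b32 b33 q1 q2 q3 =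
   coords (x1 - y1) (x2 - y2) (x3 - y3) (a11 - b11) (a12 - b12) (a13 - b13) (a21 - b21) (a22 - b22)
     (a23 - b23) (a31 - b31) (a32 - b32) (a33 - b33) (p1 - q1) (p2 - q2) (p3 - q3)"
  by (simp add: coords_def vec_eq_iff forall_3)

lemma killing_eq_sum:
  "killing X Y = (\<Sum>e\<in>Basis. g2_bracket X (g2_bracket Y (g2_proj e)) \<bullet> e)"
  unfolding killing_def
proof (rule trace_on_eq_sum[OF subspace_g2])
  show "linear (\<lambda>Z. g2_bracket X (g2_bracket Y Z))"
    using linear_compose[OF linear_g2_bracket linear_g2_bracket] by (simp add: o_def)
  show "linear g2_proj"
  proof (rule linearI)
    show "g2_proj (X + Y) = g2_proj X + g2_proj Y" for X Y
      by (rule coords_exhaust[of X], rule coords_exhaust[of Y]) (simp add: g2_proj_def field_simps)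
    show "g2_proj (r *\<^sub>R X) = r *\<^sub>R g2_proj X" for r X
      by (rule coords_exhaust[of X]) (simp add: g2_proj_def field_simps)
  qed
  show "g2_proj Z \<in> g2" for Z
    by (rule coords_exhaust[of Z]) (simp add: g2_proj_def coords_in_g2 field_simps)
  show "g2_proj Z = Z" if "Z \<in> g2" for Z
    using that by (rule_tac coords_exhaust[of Z]) (simp add: g2_proj_def coords_in_g2)
qed (rule g2_bracket_in_g2)

section \<open>Exponentials of the two nilpotent elements\<close>

definition ad :: "gvec \<Rightarrow> nat \<Rightarrow> gvec \<Rightarrow> gvec" where
  "ad Y k = (g2_bracket Y ^^ k)"

lemma ad_0 [simp]: "ad Y 0 X = X"
  and ad_Suc [simp]: "ad Y (Suc k) X = g2_bracket Y (ad Y k X)"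
  by (simp_all add: ad_def)

text \<open>Odd and even parts of \<open>exp (ad Y) V\<^sub>1\<close> for the nilpotent elements \<open>Y = e\<^sup>1 + e\<^sub>3\<^sup>1\<close>
  and \<open>Y = e\<^sub>3\<^sup>2 + e\<^sup>1\<close>, whose exponentials are \<open>a\<^sub>1\<close> and \<open>a\<^sub>2\<close>.\<close>

definition odd_1 :: gvec where
  "odd_1 = 3 *\<^sub>R ev 2 + (- 3) *\<^sub>R emat 1 3 + 3 *\<^sub>R emat 3 1 + 3 *\<^sub>R ecov 1"

definition even_1 :: gvec where
  "even_1 = 3 *\<^sub>R emat 1 1 + (- 3) *\<^sub>R emat 3 3 + ((- 3) *\<^sub>R emat 2 1 + (- 3) *\<^sub>R ecov 3)"

definition odd_2 :: gvec where
  "odd_2 = 3 *\<^sub>R ev 2 + (- 3) *\<^sub>R emat 1 3 + (- 3) *\<^sub>R emat 3 1 + 3 *\<^sub>R ecov 2"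

definition even_2 :: gvec where
  "even_2 = 3 *\<^sub>R ev 3 + 3 *\<^sub>R emat 1 2 + (- 3) *\<^sub>R emat 2 1 + (- 3) *\<^sub>R ecov 3"

lemma exp_ad_1:
  "ad (ecov 1 + emat 3 1) 5 ((- 3) *\<^sub>R emat 1 3) = 0"
  "(\<Sum>k<5. (1 / fact k) *\<^sub>R ad (ecov 1 + emat 3 1) k ((- 3) *\<^sub>R emat 1 3)) = odd_1 + even_1"
  by (simp_all add: odd_1_def even_1_def eval_nat_numeral basis_coords g2_bracket_coords zero_coords)

text \<open>The fourth power leads from the highest to the lowest root space, to \<open>- 72\<close>
  times \<open>emat 3 1\<close>, so the series has five terms. The same length is taken for the
  other element.\<close>

lemma exp_ad_2:
  "ad (emat 3 2 + ecov 1) 5 ((- 3) *\<^sub>R emat 1 3) = 0"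
  "(\<Sum>k<5. (1 / fact k) *\<^sub>R ad (emat 3 2 + ecov 1) k ((- 3) *\<^sub>R emat 1 3)) = odd_2 + even_2"
  by (simp_all add: odd_2_def even_2_def eval_nat_numeral basis_coords g2_bracket_coords zero_coords)

lemma odd_in_g_odd: "odd_1 \<in> g_odd" "odd_2 \<in> g_odd"
  unfolding odd_1_def odd_2_def g_odd_def by (intro span_add span_scale span_base; simp)+

lemma even_in_g_ev: "even_1 \<in> g_ev" "even_2 \<in> g_ev"
proof -
  have "3 *\<^sub>R emat 1 1 + (- 3) *\<^sub>R emat 3 3 \<in> cartan"
    by (simp add: cartan_coords basis_coords)
  moreover have "(- 3) *\<^sub>R emat 2 1 + (- 3) *\<^sub>R ecov 3 \<in> span {ev 3, ecov 3, emat 1 2, emat 2 1}"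
    by (intro span_add span_scale span_base; simp)
  ultimately show "even_1 \<in> g_ev" unfolding g_ev_def even_1_def by blast
  have "even_2 \<in> span {ev 3, ecov 3, emat 1 2, emat 2 1}"
    unfolding even_2_def by (intro span_add span_scale span_base; simp)
  moreover have "0 \<in> cartan" by (simp add: cartan_coords zero_coords)
  ultimately have "0 + even_2 \<in> g_ev" unfolding g_ev_def by blast
  then show "even_2 \<in> g_ev" by simp
qed

text \<open>The form pairs \<open>emat 1 3\<close> with \<open>emat 3 1\<close> to 8 and
  \<open>ev 2\<close> with \<open>ecov 2\<close> to 24; root spaces that are not opposite are
  orthogonal. In \<open>odd_1\<close> only the first pair occurs, with coefficients -3 and 3, which
  gives -144. In \<open>odd_2\<close> its coefficients are -3 and -3, giving 144, and the second
  pair adds 432.\<close>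

lemma killing_odd: "killing odd_1 odd_1 = - 144" "killing odd_2 odd_2 = 576"
  by (simp_all add: odd_1_def odd_2_def killing_eq_sum sum_Basis_coords basis_coords g2_proj_def
      g2_bracket_coords)

lemma g_odd_subset_g2: "g_odd \<subseteq> g2"
  unfolding g_odd_def by (intro span_minimal subspace_g2) (auto simp: basis_coords coords_in_g2)

lemma g_ev_subset_g2: "g_ev \<subseteq> g2"
proof -
  have "cartan \<subseteq> g2" by (auto simp: cartan_coords coords_in_g2)
  moreover have "span {ev 3, ecov 3, emat 1 2, emat 2 1} \<subseteq> g2"
    by (intro span_minimal subspace_g2) (auto simp: basis_coords coords_in_g2)
  ultimately show ?thesis unfolding g_ev_def using subspace_add[OF subspace_g2] by blast
qed

section \<open>Linear functionals on a subspace and differentiability of curves in it\<close>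

definition linear_functional_on :: "'a::real_vector set \<Rightarrow> ('a \<Rightarrow> real) \<Rightarrow> bool" where
  "linear_functional_on W l \<longleftrightarrow> (\<forall>x\<in>W. \<forall>y\<in>W. \<forall>a b. l (a *\<^sub>R x + b *\<^sub>R y) = a * l x + b * l y)"

text \<open>The functionals in question arise from \<open>\<Phi>\<close>, which is known to be
  linear only on \<open>g2\<close>. Representing them by vectors makes the calculus of inner
  products available.\<close>

lemma linear_functional_on_inner:
  fixes W :: "'a::euclidean_space set"
  assumes W: "subspace W" and l: "linear_functional_on W l"
  obtains w where "w \<in> W" "\<And>x. x \<in> W \<Longrightarrow> l x = x \<bullet> w"
proof -
  obtain B where B: "B \<subseteq> W" "pairwise orthogonal B" "\<And>x. x \<in> B \<Longrightarrow> norm x = 1"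
    "independent B" "span B = W"
    using orthonormal_basis_subspace[OF W] by metis
  have finB: "finite B" using B(4) independent_bound by blast
  define w where "w = (\<Sum>b\<in>B. l b *\<^sub>R b)"
  have wW: "w \<in> W" unfolding w_def using B(1) W by (intro subspace_sum subspace_scale) auto
  have l0: "l 0 = 0" using l subspace_0[OF W] unfolding linear_functional_on_def by (metis add_0 mult_zero_left scaleR_zero_left)
  have "subspace {x \<in> W. l x = x \<bullet> w}"
  proof (rule subspaceI)
    fix x y assume xy: "x \<in> {x \<in> W. l x = x \<bullet> w}" "y \<in> {x \<in> W. l x = x \<bullet> w}"
    then have "l (1 *\<^sub>R x + 1 *\<^sub>R y) = 1 * l x + 1 * l y"
      using l unfolding linear_functional_on_def by blast
    then show "x + y \<in> {x \<in> W. l x = x \<bullet> w}"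
      using xy subspace_add[OF W] by (simp add: inner_add_left)
  next
    fix r x assume x: "x \<in> {x \<in> W. l x = x \<bullet> w}"
    then have "l (r *\<^sub>R x + 0 *\<^sub>R x) = r * l x + 0 * l x"
      using l unfolding linear_functional_on_def by blast
    then show "r *\<^sub>R x \<in> {x \<in> W. l x = x \<bullet> w}"
      using x subspace_scale[OF W] by simp
  qed (use l0 subspace_0[OF W] in simp)
  moreover have "B \<subseteq> {x \<in> W. l x = x \<bullet> w}"
  proof
    fix b assume b: "b \<in> B"
    have "b \<bullet> w = (\<Sum>b'\<in>B. l b' * (b \<bullet> b'))"
      by (simp add: w_def inner_sum_right)
    also have "\<dots> = (\<Sum>b'\<in>B. if b' = b then l b else 0)"
      using B(2,3) b by (intro sum.cong) (auto simp: pairwise_def orthogonal_def dot_square_norm)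
    finally show "b \<in> {x \<in> W. l x = x \<bullet> w}" using b B(1) finB by auto
  qed
  ultimately have "W \<subseteq> {x \<in> W. l x = x \<bullet> w}"
    using span_minimal B(5) by blast
  then show thesis using that wW by blast
qed

lemma linear_functional_on_deriv:
  fixes W :: "'a::euclidean_space set"
  assumes "subspace W" "linear_functional_on W l" "\<And>t. u t \<in> W" "w \<in> W"
    and u: "(u has_vector_derivative w) (at t)"
  shows "((\<lambda>t. l (u t)) has_real_derivative l w) (at t)"
proof -
  obtain v where v: "\<And>x. x \<in> W \<Longrightarrow> l x = x \<bullet> v"
    using linear_functional_on_inner[OF assms(1,2)] by metis
  show ?thesis
    using bounded_linear.has_vector_derivative[OF bounded_linear_inner_left u, of v] v assms(3,4)
    by (simp add: has_real_derivative_iff_has_vector_derivative)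
qed

text \<open>A curve is differentiable as soon as it is after applying a separating family of functionals,
  since these span the dual space.\<close>

lemma has_vector_derivative_if_separating:
  fixes W :: "'a::euclidean_space set"
  assumes W: "subspace W" and l: "\<And>h. linear_functional_on W (l h)"
    and sep: "\<And>x. x \<in> W \<Longrightarrow> (\<And>h. l h x = 0) \<Longrightarrow> x = 0"
    and u: "\<And>t. u t \<in> W" and w: "w \<in> W"
    and deriv: "\<And>h. ((\<lambda>t. l h (u t)) has_real_derivative l h w) (at t)"
  shows "(u has_vector_derivative w) (at t)"
proof -
  \<comment> \<open>The directions in which the component of \<open>u\<close> has the expected
    derivative. They form a subspace, and if it were proper some nonzero \<open>a\<close> would be
    orthogonal to it.\<close>
  define S where "S = {b. ((\<lambda>t. u t \<bullet> b) has_real_derivative w \<bullet> b) (at t)}"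
  have "subspace S"
    by (rule subspaceI) (auto simp: S_def inner_add_right intro: DERIV_add DERIV_cmult)
  have "S = UNIV"
  proof (rule ccontr)
    assume "S \<noteq> UNIV"
    then have "span S \<noteq> UNIV" using \<open>subspace S\<close> by (simp add: span_eq_iff[THEN iffD2])
    then obtain a where a: "a \<noteq> 0" "\<And>x. x \<in> S \<Longrightarrow> a \<bullet> x = 0"
      using span_not_UNIV_orthogonal span_base by metis
    obtain y z where yz: "y \<in> span W" "\<And>x. x \<in> span W \<Longrightarrow> orthogonal z x" "a = y + z"
      using orthogonal_subspace_decomp_exists[of W a] by metis
    have "x \<bullet> z = 0" if "x \<in> W" for x
      using yz(2)[of x] that span_base by (auto simp: orthogonal_def inner_commute)
    \<comment> \<open>\<open>u\<close> and \<open>w\<close> stay in \<open>W\<close>, so their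
      components along the normal part \<open>z\<close> of \<open>a\<close> vanish. Being in
      \<open>S\<close>, this part is orthogonal to \<open>a\<close>, hence 0, and \<open>a\<close>
      lies in \<open>W\<close>.\<close>
    then have "z \<in> S" using u w by (simp add: S_def)
    then have "a \<bullet> z = 0" by (rule a(2))
    moreover have "y \<bullet> z = 0" using yz(1,2) by (simp add: orthogonal_def inner_commute)
    ultimately have "z = 0" by (simp add: yz(3) inner_add_left)
    then have aW: "a \<in> W" using yz(1,3) W by (simp add: span_eq_iff[THEN iffD2])
    have "l h a = 0" for h
    proof -
      obtain v where v: "\<And>x. x \<in> W \<Longrightarrow> l h x = x \<bullet> v"
        using linear_functional_on_inner[OF W l] by metis
      \<comment> \<open>On \<open>W\<close> the functional is the inner product with
        \<open>v\<close>, so its differentiability puts \<open>v\<close> into \<open>S\<close> and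
        thus makes it orthogonal to \<open>a\<close>.\<close>
      then have "v \<in> S" using deriv[of h] u w by (simp add: S_def)
      then show ?thesis using a(2) v aW by simp
    qed
    then show False using sep aW a(1) by blast
  qed
  then show ?thesis
    unfolding has_vector_derivative_def
    by (subst has_derivative_componentwise_within)
      (auto simp: S_def has_field_derivative_def mult.commute[of _ "w \<bullet> _"])
qed

section \<open>The adjoint representation of the Iwasawa subgroup\<close>

locale g2_lie = lie G for G :: "('g, 'e::euclidean_space) lie_group_struct" (structure) +
  fixes \<Phi> :: "gvec \<Rightarrow> 'g \<Rightarrow> 'g tangent"
  assumes identification: "lie_algebra_identification G \<Phi>"
begin

lemma \<Phi>_left_invariant: "X \<in> g2 \<Longrightarrow> \<Phi> X \<in> left_invariant_fields G"
  using identification by (auto simp: lie_algebra_identification_def bij_betw_def)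

lemma \<Phi>_linear:
  "X \<in> g2 \<Longrightarrow> Y \<in> g2 \<Longrightarrow> \<Phi> (a *\<^sub>R X + b *\<^sub>R Y) p f = a * \<Phi> X p f + b * \<Phi> Y p f"
  using identification by (auto simp: lie_algebra_identification_def)

lemma \<Phi>_bracket: "X \<in> g2 \<Longrightarrow> Y \<in> g2 \<Longrightarrow> \<Phi> (g2_bracket X Y) = vf_bracket M (\<Phi> X) (\<Phi> Y)"
  using identification by (auto simp: lie_algebra_identification_def)

lemma \<Phi>_functional: "W \<subseteq> g2 \<Longrightarrow> linear_functional_on W (\<lambda>X. \<Phi> X p f)"
  unfolding linear_functional_on_def using \<Phi>_linear by blast

lemma \<Phi>_tangent: "X \<in> g2 \<Longrightarrow> \<Phi> X \<one> \<in> tangent_space M \<one>"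
  using left_invariant_at_one \<Phi>_left_invariant by blast

lemma \<Phi>_inj:
  assumes "X \<in> g2" "Y \<in> g2" "\<Phi> X \<one> = \<Phi> Y \<one>"
  shows "X = Y"
proof -
  have "\<Phi> X = \<Phi> Y"
    using left_invariant_eqI[OF assms(1,2)[THEN \<Phi>_left_invariant] assms(3)] .
  then show ?thesis
    using identification assms(1,2) by (auto simp: lie_algebra_identification_def bij_betw_def dest: inj_onD)
qed

lemma \<Phi>_zero: "\<Phi> 0 p f = 0"
  using \<Phi>_linear[OF subspace_0[OF subspace_g2] subspace_0[OF subspace_g2], of 0 0] by simp

lemma \<Phi>_scaleR: "X \<in> g2 \<Longrightarrow> \<Phi> (a *\<^sub>R X) p f = a * \<Phi> X p f"
  using \<Phi>_linear[of X X a 0] by simp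

lemma \<Phi>_add: "X \<in> g2 \<Longrightarrow> Y \<in> g2 \<Longrightarrow> \<Phi> (X + Y) p f = \<Phi> X p f + \<Phi> Y p f"
  using \<Phi>_linear[of X Y 1 1] by simp

lemma \<Phi>_sum:
  "(\<And>i. i \<in> I \<Longrightarrow> X i \<in> g2) \<Longrightarrow> \<Phi> (\<Sum>i\<in>I. X i) p f = (\<Sum>i\<in>I. \<Phi> (X i) p f)"
  by (induction I rule: infinite_finite_induct)
    (auto simp: \<Phi>_zero \<Phi>_add subspace_sum[OF subspace_g2])

lemma adjoint_deriv_\<Phi>:
  assumes "X \<in> g2" "Y \<in> g2" "curve c" "c 0 = \<one>" "velocity M c = \<Phi> Y \<one>" "f \<in> smooth_functions M"
  shows "((\<lambda>t. differential M (conjugation (c t)) (\<Phi> X \<one>) f) has_real_derivative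
    \<Phi> (g2_bracket Y X) \<one> f) (at 0)"
  using adjoint_deriv[OF assms(1,2)[THEN \<Phi>_left_invariant] assms(3-6)] \<Phi>_bracket assms(1,2) by simp

lemma ad_in_g2: "X \<in> g2 \<Longrightarrow> ad Y k X \<in> g2"
  by (cases k) (simp_all add: g2_bracket_in_g2)

text \<open>Taylor's formula is exact here because \<open>ad Y\<close> is nilpotent on \<open>X\<close>.\<close>

lemma adjoint_exp:
  assumes X: "X \<in> g2" and Y: "Y \<in> g2" and exp: "is_lie_exp G (\<Phi> Y) a" and nil: "ad Y n X = 0"
    and f: "f \<in> smooth_functions M"
  shows "differential M (conjugation a) (\<Phi> X \<one>) f = \<Phi> (\<Sum>k<n. (1 / fact k) *\<^sub>R ad Y k X) \<one> f"
proof -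
  obtain \<gamma> where \<gamma>: "curve \<gamma>" "\<And>s t. \<gamma> (s + t) = \<gamma> s \<otimes> \<gamma> t" "velocity M \<gamma> = \<Phi> Y \<one>" "\<gamma> 1 = a"
    using exp unfolding is_lie_exp_def by blast
  note [simp] = curve_closed[OF \<gamma>(1)]
  have \<gamma>0: "\<gamma> 0 = \<one>" using \<gamma>(2)[of 0 0] by (metis add_0 curve_closed[OF \<gamma>(1)] r_cancel_one)
  \<comment> \<open>These are the successive derivatives of the first one: differentiating in
    \<open>t\<close> raises the power of \<open>ad Y\<close> by one.\<close>
  define u where "u = (\<lambda>k t. differential M (conjugation (\<gamma> t)) (\<Phi> (ad Y k X) \<one>) f)"
  have deriv: "(u k has_real_derivative u (Suc k) t0) (at t0)" for k t0
  proof -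
    have Xk: "ad Y k X \<in> g2" using X by (rule ad_in_g2)
    have f': "(\<lambda>x. f (conjugation (\<gamma> t0) x)) \<in> smooth_functions M"
      using smooth_functions_compose[OF _ _ smooth_conjugation f] by simp
    \<comment> \<open>The derivative at \<open>t0\<close> is moved to 0: conjugation by
      \<open>\<gamma> t0\<close> is applied last and can be absorbed into the test function.\<close>
    have "u k (s + t0) = differential M (conjugation (\<gamma> s)) (\<Phi> (ad Y k X) \<one>) (\<lambda>x. f (conjugation (\<gamma> t0) x))" for s
      unfolding u_def differential_apply[OF f] differential_apply[OF f']
      by (rule tangent_cong[OF charted_M \<Phi>_tangent[OF Xk]])
        (simp add: add.commute[of s] \<gamma>(2) m_assoc inv_mult_group)
    moreover have "((\<lambda>s. differential M (conjugation (\<gamma> s)) (\<Phi> (ad Y k X) \<one>) (\<lambda>x. f (conjugation (\<gamma> t0) x)))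
        has_real_derivative u (Suc k) t0) (at 0)"
      using adjoint_deriv_\<Phi>[OF Xk Y \<gamma>(1) \<gamma>0 \<gamma>(3) f'] by (simp add: u_def differential_apply[OF f])
    ultimately show ?thesis using DERIV_shift[of "u k" "u (Suc k) t0" 0 t0] by simp
  qed
  have "u n t = 0" for t by (simp add: u_def nil differential_apply[OF f] \<Phi>_zero)
  moreover have "u k 0 = \<Phi> (ad Y k X) \<one> f" for k
    unfolding u_def differential_apply[OF f]
    by (rule tangent_cong[OF charted_M \<Phi>_tangent[OF ad_in_g2[OF X]]]) (simp add: \<gamma>0)
  moreover obtain t where "u 0 1 = (\<Sum>k<n. (u k 0 / fact k) * 1 ^ k) + (u n t / fact n) * 1 ^ n"
    using Maclaurin_all_le[of u "u 0" 1 n] deriv by blast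
  ultimately have "u 0 1 = (\<Sum>k<n. \<Phi> (ad Y k X) \<one> f / fact k)" by simp
  also have "\<dots> = \<Phi> (\<Sum>k<n. (1 / fact k) *\<^sub>R ad Y k X) \<one> f"
    using ad_in_g2[OF X] by (simp add: \<Phi>_sum \<Phi>_scaleR subspace_scale[OF subspace_g2])
  finally show ?thesis by (simp add: u_def \<gamma>(4))
qed

end

locale g2_iwasawa = g2_lie G \<Phi> + L: lie L
  for G :: "('g, 'e::euclidean_space) lie_group_struct" (structure)
    and \<Phi> :: "gvec \<Rightarrow> 'g \<Rightarrow> 'g tangent"
    and L :: "('g, 'l::euclidean_space) lie_group_struct" +
  assumes L_subgroup: "connected_lie_subgroup G \<Phi> L l_alg"
begin

abbreviation "\<tau> \<equiv> sub_tangent G \<Phi> L"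

lemma L_closed: "x \<in> carrier L \<Longrightarrow> x \<in> carrier G"
  and L_mult: "x \<in> carrier L \<Longrightarrow> y \<in> carrier L \<Longrightarrow> x \<otimes>\<^bsub>L\<^esub> y = x \<otimes> y"
  and L_one: "\<one>\<^bsub>L\<^esub> = \<one>"
  and smooth_inclusion: "smooth_map L.M M (\<lambda>x. x)"
  using L_subgroup subgroup.subset
  by (auto simp: connected_lie_subgroup_def lie_subgroup_def)

lemma L_inv: "x \<in> carrier L \<Longrightarrow> inv\<^bsub>L\<^esub> x = inv x"
  by (metis L.inv_closed L.l_inv L_closed L_mult L_one inv_equality)

lemma L_conjugation: "x \<in> carrier L \<Longrightarrow> y \<in> carrier L \<Longrightarrow> L.conjugation x y = conjugation x y"
  by (metis L.inv_closed L.m_closed L_inv L_mult)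

lemma inclusion_inj:
  "u \<in> tangent_space L.M \<one> \<Longrightarrow> v \<in> tangent_space L.M \<one> \<Longrightarrow>
   differential M (\<lambda>x. x) u = differential M (\<lambda>x. x) v \<Longrightarrow> u = v"
  using L_subgroup L_one L.one_closed
  by (auto simp: connected_lie_subgroup_def lie_subgroup_def inj_on_def)

lemma inclusion_image: "differential M (\<lambda>x. x) ` tangent_space L.M \<one> = (\<lambda>X. \<Phi> X \<one>) ` l_alg"
  using L_subgroup L_one by (simp add: connected_lie_subgroup_def)

lemma \<tau>_tangent: "X \<in> l_alg \<Longrightarrow> \<tau> X \<in> tangent_space L.M \<one>"
  and \<tau>_inclusion: "X \<in> l_alg \<Longrightarrow> differential M (\<lambda>x. x) (\<tau> X) = \<Phi> X \<one>"
proof -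
  assume "X \<in> l_alg"
  then have "\<Phi> X \<one> \<in> differential M (\<lambda>x. x) ` tangent_space L.M \<one>" by (simp add: inclusion_image)
  then show "\<tau> X \<in> tangent_space L.M \<one>" "differential M (\<lambda>x. x) (\<tau> X) = \<Phi> X \<one>"
    unfolding sub_tangent_def L_one by (rule inv_into_into, rule f_inv_into_f)
qed

lemma \<tau>_eqI:
  "v \<in> tangent_space L.M \<one> \<Longrightarrow> X \<in> l_alg \<Longrightarrow> differential M (\<lambda>x. x) v = \<Phi> X \<one> \<Longrightarrow> v = \<tau> X"
  using inclusion_inj \<tau>_tangent \<tau>_inclusion by simp

lemma \<tau>_surj:
  assumes "v \<in> tangent_space L.M \<one>"
  obtains X where "X \<in> l_alg" "v = \<tau> X"
proof -
  have "differential M (\<lambda>x. x) v \<in> (\<lambda>X. \<Phi> X \<one>) ` l_alg"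
    using assms inclusion_image by blast
  then show thesis using \<tau>_eqI[OF assms] that by blast
qed

lemma \<tau>_inj: "X \<in> l_alg \<Longrightarrow> Y \<in> l_alg \<Longrightarrow> \<tau> X = \<tau> Y \<Longrightarrow> X = Y"
  using \<tau>_inclusion \<Phi>_inj l_alg_subset_g2 by (metis subsetD)

text \<open>\<open>\<tau>\<close> inverts an injective linear map. The combination must first be
  known to be tangent to L, where injectivity applies; the group structure of L supplies
  this.\<close>

lemma \<tau>_linear:
  assumes "X \<in> l_alg" "Y \<in> l_alg"
  shows "\<tau> (a *\<^sub>R X + b *\<^sub>R Y) = (\<lambda>f. a * \<tau> X f + b * \<tau> Y f)"
proof (rule \<tau>_eqI[symmetric])
  show "(\<lambda>f. a * \<tau> X f + b * \<tau> Y f) \<in> tangent_space L.M \<one>"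
    using L.tangent_one_linear[of "\<tau> X" "\<tau> Y"] \<tau>_tangent assms by (simp add: L_one)
  show "a *\<^sub>R X + b *\<^sub>R Y \<in> l_alg"
    using assms subspace_l_alg by (simp add: subspace_add subspace_scale)
  show "differential M (\<lambda>x. x) (\<lambda>f. a * \<tau> X f + b * \<tau> Y f) = \<Phi> (a *\<^sub>R X + b *\<^sub>R Y) \<one>"
    using assms l_alg_subset_g2
    by (intro ext) (simp add: differential_linear \<tau>_inclusion \<Phi>_linear subsetD)
qed

lemma \<tau>_scaleR: "X \<in> l_alg \<Longrightarrow> \<tau> (a *\<^sub>R X) = (\<lambda>f. a * \<tau> X f)"
  using \<tau>_linear[of X X a 0] by simp

text \<open>Conjugation in L is the restriction of conjugation in G, so the inclusion carries the
  adjoint action of L to that of G.\<close>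

lemma L_adjoint:
  assumes p: "p \<in> carrier L" and X: "X \<in> l_alg"
  shows "differential L.M (L.conjugation p) (\<tau> X) \<in> tangent_space L.M \<one>"
    and "differential M (\<lambda>x. x) (differential L.M (L.conjugation p) (\<tau> X)) =
      differential M (conjugation p) (\<Phi> X \<one>)"
proof -
  show "differential L.M (L.conjugation p) (\<tau> X) \<in> tangent_space L.M \<one>"
    using differential_tangent[OF _ _ L.smooth_conjugation[OF p] \<tau>_tangent[OF X]] p
    by (simp add: L_one[symmetric])
  have "differential M (\<lambda>x. x) (differential L.M (L.conjugation p) (\<tau> X)) =
      differential M (\<lambda>x. L.conjugation p x) (\<tau> X)"
    by (rule differential_compose[OF L.charted_M charted_M smooth_inclusion])
  also have "\<dots> = differential M (\<lambda>x. conjugation p x) (\<tau> X)"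
    by (rule differential_cong[OF L.charted_M \<tau>_tangent[OF X]]) (use p L_conjugation in simp)
  also have "\<dots> = differential M (conjugation p) (\<Phi> X \<one>)"
    using differential_compose[OF charted_M charted_M smooth_conjugation[OF L_closed[OF p]], of "\<lambda>x. x" "\<tau> X"]
    by (simp add: \<tau>_inclusion[OF X])
  finally show "differential M (\<lambda>x. x) (differential L.M (L.conjugation p) (\<tau> X)) =
      differential M (conjugation p) (\<Phi> X \<one>)" .
qed

text \<open>The derivative is known on functions that extend to \<open>G\<close>; it carries over to all smooth
  functions on the immersed subgroup \<open>L\<close> because the curve of adjoint images stays in \<open>l_alg\<close>.\<close>

lemma L_adjoint_deriv:
  assumes X: "X \<in> l_alg" and Y: "Y \<in> l_alg" and c: "L.curve c" "c 0 = \<one>" "velocity L.M c = \<tau> Y"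
  shows "((\<lambda>t. differential L.M (L.conjugation (c t)) (\<tau> X) h) has_real_derivative
    \<tau> (g2_bracket Y X) h) (at 0)"
proof -
  have "\<exists>Z. Z \<in> l_alg \<and> differential L.M (L.conjugation (c t)) (\<tau> X) = \<tau> Z" for t
    using \<tau>_surj[OF L_adjoint(1)[OF L.curve_closed[OF c(1)] X]] by metis
  then obtain u where u: "\<And>t. u t \<in> l_alg"
    "\<And>t. differential L.M (L.conjugation (c t)) (\<tau> X) = \<tau> (u t)" by metis
  have \<Phi>u: "\<Phi> (u t) \<one> = differential M (conjugation (c t)) (\<Phi> X \<one>)" for t
    using L_adjoint(2)[OF L.curve_closed[OF c(1)] X, of t] by (simp add: u \<tau>_inclusion)
  have cG: "curve c"
    using smooth_map_compose[OF charted_euclidean L.charted_M charted_M c(1) smooth_inclusion] .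
  have vG: "velocity M c = \<Phi> Y \<one>"
    using differential_velocity[OF L.charted_M charted_M smooth_inclusion c(1)]
    by (simp add: c(3) \<tau>_inclusion[OF Y])
  have XY: "X \<in> g2" "Y \<in> g2" using X Y l_alg_subset_g2 by auto
  \<comment> \<open>The test functions on G separate the points of \<open>l_alg\<close>, since
    \<open>\<Phi> X\<close> is determined by its value at the identity.\<close>
  have "(u has_vector_derivative g2_bracket Y X) (at 0)"
  proof (rule has_vector_derivative_if_separating[OF subspace_l_alg])
    show "linear_functional_on l_alg (\<lambda>X. \<Phi> X \<one> f)" for f
      by (rule \<Phi>_functional[OF l_alg_subset_g2])
    show "x = 0" if "x \<in> l_alg" "\<And>f. \<Phi> x \<one> f = 0" for x
      using that l_alg_subset_g2 subspace_0[OF subspace_g2] by (intro \<Phi>_inj) (auto simp: \<Phi>_zero)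
    show "((\<lambda>t. \<Phi> (u t) \<one> f) has_real_derivative \<Phi> (g2_bracket Y X) \<one> f) (at 0)" for f
    proof (cases "f \<in> smooth_functions M")
      case True
      show ?thesis unfolding \<Phi>u by (rule adjoint_deriv_\<Phi>[OF XY cG c(2) vG True])
    next
      case False
      then have "\<Phi> Z \<one> f = 0" if "Z \<in> g2" for Z using tangent_nonsmooth[OF \<Phi>_tangent[OF that]] by simp
      then show ?thesis using u(1) l_alg_subset_g2 g2_bracket_in_g2 by (simp add: subsetD)
    qed
  qed (auto simp: u X Y l_alg_bracket)
  moreover have "linear_functional_on l_alg (\<lambda>X. \<tau> X h)"
    by (simp add: linear_functional_on_def \<tau>_linear)
  ultimately show ?thesis
    unfolding u(2) by (intro linear_functional_on_deriv[OF subspace_l_alg]) (auto simp: u X Y l_alg_bracket)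
qed

section \<open>Automorphisms of L and the orbit maps into G/G_ev\<close>

lemma automorphism_highest_root:
  assumes F: "F \<in> lie_aut L"
  obtains c where "differential L.M F (\<tau> ((- 3) *\<^sub>R emat 1 3)) = (\<lambda>f. c * \<tau> ((- 3) *\<^sub>R emat 1 3) f)"
    and "F \<one> = \<one>"
proof -
  have iso: "F \<in> iso L L" and sF: "smooth_map L.M L.M F"
    and sF': "smooth_map L.M L.M (inv_into (carrier L) F)"
    using F by (auto simp: lie_aut_def)
  then interpret F: group_hom L L F
    using L.is_group by (simp add: group_hom_def group_hom_axioms_def iso_def)
  have bij: "bij_betw F (carrier L) (carrier L)" using iso by (simp add: iso_def)
  have F1: "F \<one> = \<one>" using F.hom_one by (simp add: L_one)
  have F1': "inv_into (carrier L) F \<one> = \<one>"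
    using bij F1 L.one_closed L_one by (metis bij_betw_inv_into_left)
  have "\<exists>Z. Z \<in> l_alg \<and> differential L.M F (\<tau> X) = \<tau> Z" if "X \<in> l_alg" for X
    using differential_tangent[OF L.charted_M L.charted_M sF \<tau>_tangent[OF that]] \<tau>_surj F1 by metis
  then obtain f where f: "\<And>X. X \<in> l_alg \<Longrightarrow> f X \<in> l_alg"
    "\<And>X. X \<in> l_alg \<Longrightarrow> differential L.M F (\<tau> X) = \<tau> (f X)" by metis
  \<comment> \<open>That \<open>f V\<close> spans an ideal has to be tested against all of
    \<open>l_alg\<close>, so every element must be an image; the inverse automorphism provides the
    preimages.\<close>
  have f_surj: "\<exists>Y\<in>l_alg. f Y = Z" if "Z \<in> l_alg" for Z
  proof -
    have "differential L.M (inv_into (carrier L) F) (\<tau> Z) \<in> tangent_space L.M \<one>"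
      using differential_tangent[OF L.charted_M L.charted_M sF' \<tau>_tangent[OF that]] F1' by simp
    then obtain Y where Y: "Y \<in> l_alg" "differential L.M (inv_into (carrier L) F) (\<tau> Z) = \<tau> Y"
      by (rule \<tau>_surj)
    have "\<tau> (f Y) = differential L.M (\<lambda>x. F (inv_into (carrier L) F x)) (\<tau> Z)"
      using f(2)[OF Y(1)] differential_compose[OF L.charted_M L.charted_M sF] Y(2) by metis
    also have "\<dots> = differential L.M (\<lambda>x. x) (\<tau> Z)"
      using bij by (intro differential_cong[OF L.charted_M \<tau>_tangent[OF that]])
        (simp add: bij_betw_inv_into_right)
    also have "\<dots> = \<tau> Z" by (rule differential_ident[OF \<tau>_tangent[OF that]])
    finally show ?thesis using Y(1) \<tau>_inj f(1) that by blast
  qed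
  have bracket: "\<tau> (g2_bracket (f Y) (f X)) = differential L.M F (\<tau> (g2_bracket Y X))"
    if X: "X \<in> l_alg" and Y: "Y \<in> l_alg" for X Y
  proof
    fix h
    show "\<tau> (g2_bracket (f Y) (f X)) h = differential L.M F (\<tau> (g2_bracket Y X)) h"
    proof (cases "h \<in> smooth_functions L.M")
      case False
      then show ?thesis
        using tangent_nonsmooth[OF \<tau>_tangent] l_alg_bracket f(1) X Y by (simp add: differential_def)
    next
      case True
      obtain c where c: "L.curve c" "c 0 = \<one>" "\<tau> Y = velocity L.M c"
        using \<tau>_tangent[OF Y] by (rule tangent_spaceE)
      have Fc: "L.curve (\<lambda>t. F (c t))" "velocity L.M (\<lambda>t. F (c t)) = \<tau> (f Y)"
        using smooth_map_compose[OF charted_euclidean L.charted_M L.charted_M c(1) sF]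
          differential_velocity[OF L.charted_M L.charted_M sF c(1)] f(2)[OF Y] c(3) by simp_all
      have hF: "(\<lambda>x. h (F x)) \<in> smooth_functions L.M"
        by (rule smooth_functions_compose[OF L.charted_M L.charted_M sF True])
      \<comment> \<open>Since \<open>F\<close> is a homomorphism, conjugating by \<open>c t\<close>
        and then applying \<open>F\<close> is the same as applying \<open>F\<close> and then
        conjugating by \<open>F (c t)\<close>. One function of \<open>t\<close> thus has two
        computed derivatives, and their equality is the bracket identity.\<close>
      have "differential L.M (L.conjugation (F (c t))) (\<tau> (f X)) h =
        differential L.M (L.conjugation (c t)) (\<tau> X) (\<lambda>x. h (F x))" for t
      proof -
        have h': "(\<lambda>x. h (L.conjugation (F (c t)) x)) \<in> smooth_functions L.M"
          using smooth_functions_compose[OF _ _ L.smooth_conjugation True] L.curve_closed[OF Fc(1)] by simp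
        show ?thesis
          unfolding f(2)[OF X, symmetric] differential_apply[OF True] differential_apply[OF hF] differential_apply[OF h']
          by (rule tangent_cong[OF L.charted_M \<tau>_tangent[OF X]])
            (use L.curve_closed[OF c(1)] in simp)
      qed
      then have "((\<lambda>t. differential L.M (L.conjugation (c t)) (\<tau> X) (\<lambda>x. h (F x))) has_real_derivative
          \<tau> (g2_bracket (f Y) (f X)) h) (at 0)"
        using L_adjoint_deriv[OF f(1)[OF X] f(1)[OF Y] Fc(1) _ Fc(2), of h] F1 c(2) by simp
      with L_adjoint_deriv[OF X Y c(1,2) c(3)[symmetric], of "\<lambda>x. h (F x)"]
      show ?thesis by (simp add: differential_apply[OF True] DERIV_unique)
    qed
  qed
  define V where "V = emat 1 3"
  have V: "V \<in> l_alg" by (simp add: V_def emat_13_in_l_alg)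
  have "\<exists>c. f V = c *\<^sub>R emat 1 3"
  proof (rule l_alg_ideal_unique[OF f(1)[OF V]])
    fix Z assume "Z \<in> l_alg"
    then obtain Y where Y: "Y \<in> l_alg" "f Y = Z" using f_surj by blast
    obtain \<mu> where \<mu>: "g2_bracket Y V = \<mu> *\<^sub>R V" using emat_13_ideal[OF Y(1)] V_def by blast
    have "\<tau> (g2_bracket Z (f V)) = differential L.M F (\<lambda>f. \<mu> * \<tau> V f)"
      using bracket[OF V Y(1)] by (simp add: Y(2) \<mu> \<tau>_scaleR[OF V])
    also have "\<dots> = (\<lambda>f. \<mu> * differential L.M F (\<tau> V) f)"
      using differential_linear[of L.M F \<mu> "\<tau> V" 0 "\<tau> V"] by simp
    also have "\<dots> = \<tau> (\<mu> *\<^sub>R f V)" by (simp add: f V \<tau>_scaleR)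
    finally have "g2_bracket Z (f V) = \<mu> *\<^sub>R f V"
      using \<open>Z \<in> l_alg\<close> f(1)[OF V] subspace_l_alg by (intro \<tau>_inj l_alg_bracket) (auto simp: subspace_scale)
    then show "\<exists>\<mu>. g2_bracket Z (f V) = \<mu> *\<^sub>R f V" by blast
  qed
  then obtain c where c: "f V = c *\<^sub>R V" using V_def by blast
  have "differential L.M F (\<tau> ((- 3) *\<^sub>R V)) = (\<lambda>h. (- 3) * differential L.M F (\<tau> V) h)"
    using differential_linear[of L.M F "- 3" "\<tau> V" 0 "\<tau> V"] unfolding \<tau>_scaleR[OF V] by simp
  also have "\<dots> = (\<lambda>h. c * \<tau> ((- 3) *\<^sub>R V) h)"
    unfolding f(2)[OF V] c \<tau>_scaleR[OF V] by (simp add: mult.left_commute)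
  finally show thesis using that F1 V_def by blast
qed

text \<open>The orbit map is conjugation by \<open>a\<close> followed by the projection to cosets.
  Its differential sends \<open>V\<close> to the class of \<open>exp (ad Y) V = X + Z\<close>, where
  the even part \<open>Z\<close> dies because it is tangent to G_ev and the projection is constant
  there. The base point is fixed, so both pulled-back metrics are read off at the same point of
  G/G_ev.\<close>

lemma conj_orbit_differential:
  fixes Gev :: "('g, 'h::euclidean_space) lie_group_struct" and S :: "('g set, 's::euclidean_space) manifold"
  assumes Gev: "connected_lie_subgroup G \<Phi> Gev g_ev" and S: "homogeneous_space G (carrier Gev) S"
    and V: "V \<in> l_alg" and Y: "Y \<in> g2" and a: "is_lie_exp G (\<Phi> Y) a"
    and nil: "ad Y n V = 0" and sum: "(\<Sum>k<n. (1 / fact k) *\<^sub>R ad Y k V) = X + Z"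
    and X: "X \<in> g_odd" and Z: "Z \<in> g_ev"
  shows "conj_orbit G (carrier Gev) a \<one> = carrier Gev"
    and "differential S (conj_orbit G (carrier Gev) a) (\<tau> V) =
      differential S (\<lambda>x. x <# carrier Gev) (\<Phi> X \<one>)"
    and "\<And>X. X \<in> g2 \<Longrightarrow> differential S (\<lambda>x. x <# carrier Gev) (\<Phi> X \<one>) \<in> tangent_space S (carrier Gev)"
    and "carrier Gev \<in> man_space S"
proof -
  let ?\<pi> = "\<lambda>x. x <# carrier Gev"
  have sub: "subgroup (carrier Gev) G" and lie_Gev: "lie_group Gev" and one: "\<one>\<^bsub>Gev\<^esub> = \<one>"
    and incl: "smooth_map (lg_man Gev) M (\<lambda>x. x)"
    and img: "differential M (\<lambda>x. x) ` tangent_space (lg_man Gev) \<one> = (\<lambda>X. \<Phi> X \<one>) ` g_ev"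
    using Gev by (auto simp: connected_lie_subgroup_def lie_subgroup_def)
  have chGev: "charted (lg_man Gev)" and spGev: "man_space (lg_man Gev) = carrier Gev"
    using lie_Gev charted_smooth_manifold by (auto simp: lie_group_def)
  have chS: "charted S" and s\<pi>: "smooth_map M S ?\<pi>" and spS: "man_space S = lcosets (carrier Gev)"
    using S charted_smooth_manifold by (auto simp: homogeneous_space_def)
  have \<pi>1: "?\<pi> \<one> = carrier Gev" using lcos_mult_one[OF subgroup.subset[OF sub]] .
  have aG: "a \<in> carrier G" using a curve_closed unfolding is_lie_exp_def by blast
  have XZ: "X \<in> g2" "Z \<in> g2" using X Z g_odd_subset_g2 g_ev_subset_g2 by auto
  have Vg: "V \<in> g2" using V l_alg_subset_g2 by blast
  show "conj_orbit G (carrier Gev) a \<one> = carrier Gev"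
    using aG \<pi>1 by (simp add: conj_orbit_def)
  show "differential S ?\<pi> (\<Phi> X \<one>) \<in> tangent_space S (carrier Gev)" if "X \<in> g2" for X
    using differential_tangent[OF charted_M chS s\<pi> \<Phi>_tangent[OF that]] \<pi>1 by simp
  show "carrier Gev \<in> man_space S"
    using \<pi>1 one_closed unfolding spS LCOSETS_def by blast
  show "differential S (conj_orbit G (carrier Gev) a) (\<tau> V) = differential S ?\<pi> (\<Phi> X \<one>)"
  proof
    fix f
    show "differential S (conj_orbit G (carrier Gev) a) (\<tau> V) f = differential S ?\<pi> (\<Phi> X \<one>) f"
    proof (cases "f \<in> smooth_functions S")
      case True
      have f\<pi>: "(\<lambda>x. f (?\<pi> x)) \<in> smooth_functions M"
        by (rule smooth_functions_compose[OF charted_M chS s\<pi> True])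
      have f\<pi>a: "(\<lambda>x. f (?\<pi> (conjugation a x))) \<in> smooth_functions M"
        by (rule smooth_functions_compose[OF charted_M charted_M smooth_conjugation[OF aG] f\<pi>])
      have "\<Phi> Z \<one> (\<lambda>x. f (?\<pi> x)) = 0"
      proof -
        obtain v where v: "v \<in> tangent_space (lg_man Gev) \<one>" "\<Phi> Z \<one> = differential M (\<lambda>x. x) v"
          using img Z by blast
        obtain c where c: "smooth_map euclidean_manifold (lg_man Gev) c" "v = velocity (lg_man Gev) c"
          using v(1) by (rule tangent_spaceE)
        have "c t \<in> carrier Gev" for t
          using smooth_map_in_space[OF c(1), of t] spGev by simp
        then have "?\<pi> (c t) = carrier Gev" for t
          using sub coset_join3 subgroup.mem_carrier by metis
        then show ?thesis
          using differential_velocity[OF chGev charted_M incl c(1)] f\<pi> by (simp add: v c velocity_apply)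
      qed
      then have "\<Phi> (X + Z) \<one> (\<lambda>x. f (?\<pi> x)) = \<Phi> X \<one> (\<lambda>x. f (?\<pi> x))"
        using XZ by (simp add: \<Phi>_add)
      then have "differential M (conjugation a) (\<Phi> V \<one>) (\<lambda>x. f (?\<pi> x)) = \<Phi> X \<one> (\<lambda>x. f (?\<pi> x))"
        using adjoint_exp[OF Vg Y a nil f\<pi>] sum by simp
      moreover have "differential M (conjugation a) (\<Phi> V \<one>) (\<lambda>x. f (?\<pi> x)) =
          \<tau> V (\<lambda>x. f (?\<pi> (conjugation a x)))"
        using differential_apply[OF f\<pi>a, of "\<lambda>x. x" "\<tau> V"]
        by (simp add: differential_apply[OF f\<pi>] \<tau>_inclusion[OF V])
      ultimately show ?thesis by (simp add: differential_apply[OF True] conj_orbit_def)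
    qed (simp add: differential_def)
  qed
qed

end

text \<open>The definition gives linearity in the first slot; symmetry moves the second factor
  there.\<close>

lemma pseudo_riemannian_metric_scale:
  assumes "pseudo_riemannian_metric N g" "p \<in> man_space N" "v \<in> tangent_space N p"
    and "(\<lambda>f. c * v f) \<in> tangent_space N p"
  shows "g p (\<lambda>f. c * v f) (\<lambda>f. c * v f) = c\<^sup>2 * g p v v"
proof -
  let ?w = "\<lambda>f. c * v f"
  have sym: "g p u w = g p w u" if "u \<in> tangent_space N p" "w \<in> tangent_space N p" for u w
    using assms(1,2) that unfolding pseudo_riemannian_metric_def by blast
  have lin: "g p (\<lambda>f. a * u f + b * x f) w = a * g p u w + b * g p x w"
    if "u \<in> tangent_space N p" "x \<in> tangent_space N p" "w \<in> tangent_space N p" for u x w a b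
    using assms(1,2) that unfolding pseudo_riemannian_metric_def by blast
  have scale: "g p ?w w = c * g p v w" if "w \<in> tangent_space N p" for w
    using lin[OF assms(3,3) that, of c 0] by simp
  have "g p ?w ?w = c * g p v ?w" by (rule scale[OF assms(4)])
  also have "g p v ?w = g p ?w v" by (rule sym[OF assms(3,4)])
  also have "\<dots> = c * g p v v" by (rule scale[OF assms(3)])
  finally show ?thesis by (simp add: power2_eq_square)
qed

theorem proposition9:
  fixes G :: "('g, 'e::euclidean_space) lie_group_struct"
    and \<Phi> :: "gvec \<Rightarrow> 'g \<Rightarrow> 'g tangent"
    and Gev :: "('g, 'h::euclidean_space) lie_group_struct"
    and L :: "('g, 'l::euclidean_space) lie_group_struct"
    and S :: "('g set, 's::euclidean_space) manifold"
    and g_TS g_ST :: "'g metric_tensor"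
    and g_S :: "'g set metric_tensor"
    and a1 a2 :: 'g
  assumes "lie_group G"
    and "simply_connected_space (man_top (lg_man G))"
    and "lie_algebra_identification G \<Phi>"
    and "connected_lie_subgroup G \<Phi> Gev g_ev"
    and "connected_lie_subgroup G \<Phi> L l_alg"
    and "left_invariant_metric L g_TS"
    and "gram_diag G \<Phi> L g_TS [-1, 1, -1, 1, -1, 1, 1, -1]"
    and "left_invariant_metric L g_ST"
    and "gram_diag G \<Phi> L g_ST [1, 1, 1, 1, -1, -1, -1, -1]"
    and "homogeneous_space G (carrier Gev) S"
    and "is_gS G \<Phi> (carrier Gev) S g_S"
    and "is_lie_exp G (\<Phi> (ecov 1 + emat 3 1)) a1"
    and "is_lie_exp G (\<Phi> (emat 3 2 + ecov 1)) a2"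
  shows "\<not> (\<exists>F\<in>lie_aut L. metric_eq (lg_man L) (pullback_metric (lg_man L) F g_TS) g_ST)
    \<and> \<not> (\<exists>F\<in>lie_aut L. metric_eq (lg_man L)
          (pullback_metric (lg_man L) F (pullback_metric S (conj_orbit G (carrier Gev) a1) g_S))
          (pullback_metric S (conj_orbit G (carrier Gev) a2) g_S))"
proof -
  interpret G: lie G
    using assms(1) by (simp add: lie_def lie_axioms_def lie_group_def)
  have lieL: "lie_group L" using assms(5) by (simp add: connected_lie_subgroup_def lie_subgroup_def)
  then interpret L: lie L
    by (simp add: lie_def lie_axioms_def lie_group_def)
  interpret g2_iwasawa G \<Phi> L
    by unfold_locales (use assms(3,5) in auto)
  define V :: gvec where "V = (- 3) *\<^sub>R emat 1 3"
  have V: "V \<in> l_alg" unfolding V_def using emat_13_in_l_alg subspace_l_alg by (simp only: subspace_scale)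
  note v = \<tau>_tangent[OF V]
  have V0: "l_basis ! 0 = V" by (simp add: l_basis_def V_def)
  have one: "\<one>\<^bsub>G\<^esub> \<in> man_space (lg_man L)" using L.one_closed L_one by simp
  show ?thesis
  proof (intro conjI notI; elim bexE)
    fix F assume F: "F \<in> lie_aut L" and eq: "metric_eq (lg_man L) (pullback_metric (lg_man L) F g_TS) g_ST"
    obtain c where c: "differential (lg_man L) F (\<tau> V) = (\<lambda>f. c * \<tau> V f)" "F \<one>\<^bsub>G\<^esub> = \<one>\<^bsub>G\<^esub>"
      using automorphism_highest_root[OF F] unfolding V_def by blast
    have cv: "(\<lambda>f. c * \<tau> V f) \<in> tangent_space (lg_man L) \<one>\<^bsub>G\<^esub>"
      using L.tangent_one_linear[of "\<tau> V" "\<tau> V" c 0] v by (simp add: L_one)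
    have "g_TS \<one>\<^bsub>G\<^esub> (\<lambda>f. c * \<tau> V f) (\<lambda>f. c * \<tau> V f) = g_ST \<one>\<^bsub>G\<^esub> (\<tau> V) (\<tau> V)"
      using eq[unfolded metric_eq_def pullback_metric_def, THEN bspec, OF one, THEN bspec, OF v, THEN bspec, OF v]
      by (simp add: c)
    moreover have "g_TS \<one>\<^bsub>G\<^esub> (\<lambda>f. c * \<tau> V f) (\<lambda>f. c * \<tau> V f) = c\<^sup>2 * g_TS \<one>\<^bsub>G\<^esub> (\<tau> V) (\<tau> V)"
      using assms(6) by (intro pseudo_riemannian_metric_scale[OF _ one v cv]) (simp add: left_invariant_metric_def)
    moreover have "g_TS \<one>\<^bsub>G\<^esub> (\<tau> V) (\<tau> V) = - 1 / 4" "g_ST \<one>\<^bsub>G\<^esub> (\<tau> V) (\<tau> V) = 1 / 4"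
      using assms(7,9)[unfolded gram_diag_def, THEN spec[of _ 0], THEN mp, THEN spec[of _ 0]]
      by (simp_all add: V0 L_one)
    ultimately have "- c\<^sup>2 = 1" by simp
    then show False using zero_le_power2[of c] by linarith
  next
    fix F assume F: "F \<in> lie_aut L" and eq: "metric_eq (lg_man L)
          (pullback_metric (lg_man L) F (pullback_metric S (conj_orbit G (carrier Gev) a1) g_S))
          (pullback_metric S (conj_orbit G (carrier Gev) a2) g_S)"
    obtain c where c: "differential (lg_man L) F (\<tau> V) = (\<lambda>f. c * \<tau> V f)" "F \<one>\<^bsub>G\<^esub> = \<one>\<^bsub>G\<^esub>"
      using automorphism_highest_root[OF F] unfolding V_def by blast
    define w where "w X = differential S (\<lambda>x. x <#\<^bsub>G\<^esub> carrier Gev) (\<Phi> X \<one>\<^bsub>G\<^esub>)" for X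
    have Y1: "ecov 1 + emat 3 1 \<in> g2" and Y2: "emat 3 2 + ecov 1 \<in> g2"
      by (simp_all add: basis_coords coords_in_g2)
    note phi1 = conj_orbit_differential[OF assms(4,10) V Y1 assms(12) exp_ad_1[folded V_def] odd_in_g_odd(1) even_in_g_ev(1), folded w_def]
    note phi2 = conj_orbit_differential[OF assms(4,10) V Y2 assms(13) exp_ad_2[folded V_def] odd_in_g_odd(2) even_in_g_ev(2), folded w_def]
    have scaled: "differential S (conj_orbit G (carrier Gev) a1) (\<lambda>f. c * \<tau> V f) = (\<lambda>f. c * w odd_1 f)"
      using differential_linear[of S "conj_orbit G (carrier Gev) a1" c "\<tau> V" 0 "\<tau> V"] by (simp add: phi1(2))
    have odd_1_g2: "odd_1 \<in> g2" using odd_in_g_odd(1) g_odd_subset_g2 by blast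
    \<comment> \<open>Bilinearity is available for tangent vectors only, so the multiple is
      exhibited as the class of an element of \<open>g2\<close>.\<close>
    have "w (c *\<^sub>R odd_1) = (\<lambda>f. c * w odd_1 f)"
      by (auto simp: w_def differential_def \<Phi>_scaleR[OF odd_1_g2])
    then have cw: "(\<lambda>f. c * w odd_1 f) \<in> tangent_space S (carrier Gev)"
      using phi1(3)[of "c *\<^sub>R odd_1"] odd_1_g2 subspace_scale[OF subspace_g2] by simp
    have "g_S (carrier Gev) (\<lambda>f. c * w odd_1 f) (\<lambda>f. c * w odd_1 f) = g_S (carrier Gev) (w odd_2) (w odd_2)"
      using eq[unfolded metric_eq_def pullback_metric_def, THEN bspec, OF one, THEN bspec, OF v, THEN bspec, OF v]
      by (simp add: c phi1(1) phi2(1,2) scaled)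
    moreover have "g_S (carrier Gev) (\<lambda>f. c * w odd_1 f) (\<lambda>f. c * w odd_1 f) = c\<^sup>2 * g_S (carrier Gev) (w odd_1) (w odd_1)"
      using assms(11) by (intro pseudo_riemannian_metric_scale[OF _ phi1(4) phi1(3)[OF odd_1_g2] cw]) (simp add: is_gS_def)
    moreover have "g_S (carrier Gev) (w X) (w X) = killing X X / 8" if "X \<in> g_odd" for X
      using assms(11) that by (auto simp: is_gS_def w_def)
    ultimately have "c\<^sup>2 * (- 144 / 8) = 576 / 8"
      using odd_in_g_odd killing_odd by simp
    then show False using zero_le_power2[of c] by linarith
  qed
qed

end
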